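(* There is a universal integer $q>0$ such that for every $n\geq 1$, if $A$ is a permutation invariant closed set in $\mathbb{R}^n$ with $\gamma_n(A)\geq \frac23$, then there is a permutation invariant convex body $K$ in $\mathbb{R}^n$ with $$\gamma_n(K)\geq \frac12\quad\text{and}\quad K\subset \underbrace{A+\cdots+A}_{q\text{ times}}.$$
   Context: $\gamma_n$ is the standard Gaussian measure on $\mathbb{R}^n$ and $A+\cdots+A$ is the Minkowski sum. A set $A\subset\mathbb{R}^n$ is permutation invariant if $(x_1,\dots,x_n)\in A$ if and only if $(x_{\sigma(1)},\dots,x_{\sigma(n)})\in A$, for any permutation $\sigma$ of $\{1,\dots,n\}$. *)

theory Defs
  imports "HOL-Probability.Probability" "HOL-Combinatorics.Permutations"
begin

text \<open>
  The constant \<open>q\<close> of the theorem does not depend on the dimension \<open>n\<close>, so the dimension has to be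
  a natural number rather than a type. Points of \<open>\<real>\<^sup>n\<close> are the extensional functions on \<open>{..<n}\<close>, as
  in \<^const>\<open>PiM\<close> and \<^const>\<open>product_topology\<close>; vector operations are therefore restricted
  to \<open>{..<n}\<close>, and coordinates are numbered from \<open>0\<close>.
\<close>

definition Rn :: "nat \<Rightarrow> (nat \<Rightarrow> real) topology" where
  "Rn n = product_topology (\<lambda>_. euclideanreal) {..<n}"

definition std_gaussian :: "nat \<Rightarrow> (nat \<Rightarrow> real) measure" where
  "std_gaussian n = PiM {..<n} (\<lambda>_. density lborel (\<lambda>x. ennreal (std_normal_density x)))"

text \<open>A permutation of \<open>{..<n}\<close> in the sense of \<^const>\<open>permutes\<close> fixes all \<open>i \<ge> n\<close>, so
  \<open>x \<circ> \<sigma>\<close> is again extensional.\<close>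

definition permutation_invariant :: "nat \<Rightarrow> (nat \<Rightarrow> real) set \<Rightarrow> bool" where
  "permutation_invariant n A \<longleftrightarrow>
     (\<forall>\<sigma>. \<sigma> permutes {..<n} \<longrightarrow> (\<forall>x\<in>topspace (Rn n). x \<in> A \<longleftrightarrow> x \<circ> \<sigma> \<in> A))"

definition minkowski_multiple :: "nat \<Rightarrow> nat \<Rightarrow> (nat \<Rightarrow> real) set \<Rightarrow> (nat \<Rightarrow> real) set" where
  "minkowski_multiple n q A = {(\<lambda>i\<in>{..<n}. \<Sum>j<q. a j i) | a. \<forall>j<q. a j \<in> A}"

definition convex_in :: "nat \<Rightarrow> (nat \<Rightarrow> real) set \<Rightarrow> bool" where
  "convex_in n K \<longleftrightarrow>
     (\<forall>x\<in>K. \<forall>y\<in>K. \<forall>u\<ge>0. \<forall>v\<ge>0. u + v = 1 \<longrightarrow> (\<lambda>i\<in>{..<n}. u * x i + v * y i) \<in> K)"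

definition convex_body :: "nat \<Rightarrow> (nat \<Rightarrow> real) set \<Rightarrow> bool" where
  "convex_body n K \<longleftrightarrow> compactin (Rn n) K \<and> convex_in n K \<and> Rn n interior_of K \<noteq> {}"

lemma topspace_Rn: "topspace (Rn n) = {..<n} \<rightarrow>\<^sub>E UNIV"
  by (simp add: Rn_def)

lemma space_std_gaussian: "space (std_gaussian n) = topspace (Rn n)"
  by (simp add: std_gaussian_def Rn_def space_PiM)

lemma prob_space_std_gaussian: "prob_space (std_gaussian n)"
  unfolding std_gaussian_def
  by (intro prob_space_PiM prob_space_normal_density) simp

end

theory Submission
  imports Defs
begin

text \<open>
  The body is the set \<open>K\<close> of all \<open>x\<close> with \<open>\<bar>\<Sum>x\<^sub>i\<bar> \<le> 4\<surd>n\<close> and \<open>\<Sum>exp (x\<^sub>i\<^sup>2/4) \<le> 4n\<close>. Since \<open>2/3 > 1/2\<close>,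
  a vector lies in \<open>A + A\<close> as soon as it can be written, up to a permutation of its coordinates
  and with probability greater than \<open>2/3\<close>, as a sum of two dependent standard Gaussian vectors. Two
  kinds of vectors are treated in this way.

  First, a vector \<open>z\<close> of norm at most \<open>1/5\<close> is \<open>g + (z - g)\<close>, where the law of \<open>z - g\<close> is close enough
  to the Gaussian measure. Second, vectors consisting of disjoint pairs \<open>(u, -u)\<close> and zeros: two coordinates
  \<open>(g, g')\<close> can be moved to \<open>(g + u, g' - u)\<close> or \<open>(g - u, g' + u)\<close>, with equal probability, or left
  alone, so that their joint law is preserved and a move occurs with probability \<open>exp (-u\<^sup>2/2)/2\<close>.
  Running through disjoint pairs of coordinates and retrying each \<open>u\<close> until it succeeds, one needs
  \<open>\<Sum>2 exp (u\<^sup>2/2)\<close> attempts on average, so by Markov's inequality all \<open>u\<close> are placed if this sum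
  is small compared to \<open>n\<close>.

  It remains to split \<open>x \<in> K\<close> into boundedly many such vectors. After scaling and removing the mean
  (which has bounded norm), \<open>x\<close> has sum zero, so \<open>x\<^sub>i = f\<^sub>i\<^sub>+\<^sub>1 - f\<^sub>i\<close> for the partial sums \<open>f\<close>, and the edges
  \<open>(i, i+1)\<close> of the path with a given residue of \<open>i\<close> modulo \<open>48\<close> form a vector of disjoint pairs
  \<open>(f\<^sub>i, -f\<^sub>i)\<close>. If \<open>x\<close> is bounded, it can be ordered so that \<open>f\<close> is bounded too. The few large entries are
  dissipated beforehand along the path by the recursion \<open>g\<^sub>i\<^sub>+\<^sub>1 = soft (g\<^sub>i + x\<^sub>i)\<close>, where
  \<open>soft\<close> moves its argument towards \<open>0\<close> by at most \<open>1\<close>: then \<open>x\<^sub>i - (g\<^sub>i\<^sub>+\<^sub>1 - g\<^sub>i)\<close> is bounded by \<open>1\<close>, and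
  \<open>g\<close> returns to zero quickly if every large entry is followed by sufficiently many small ones.
\<close>

subsection \<open>Swapping mass between pairs of coordinates\<close>

abbreviation std_normal :: "real measure" where
  "std_normal \<equiv> density lborel (\<lambda>x. ennreal (std_normal_density x))"

lemma nn_integral_lborel_shift:
  fixes f :: "'a::euclidean_space \<Rightarrow> ennreal"
  assumes [measurable]: "f \<in> borel_measurable borel"
  shows "(\<integral>\<^sup>+z. f (c + z) \<partial>lborel) = (\<integral>\<^sup>+z. f z \<partial>lborel)"
proof -
  have "(\<integral>\<^sup>+z. f z \<partial>distr lborel borel ((+) c)) = (\<integral>\<^sup>+z. f (c + z) \<partial>lborel)"
    by (rule nn_integral_distr) auto
  then show ?thesis by (simp add: lborel_distr_plus)
qed

text \<open>The mass \<open>h\<close> is exchanged between \<open>z\<close> and \<open>w + z\<close>, the mass \<open>r\<close> stays in place.\<close>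

lemma swap_mass_bound:
  fixes d h r a b :: "'a::euclidean_space \<Rightarrow> ennreal"
  assumes [measurable]: "h \<in> borel_measurable borel" "r \<in> borel_measurable borel"
      "a \<in> borel_measurable borel" "b \<in> borel_measurable borel"
    and d: "\<And>z. d z = h z + h (- w + z) + r z"
    and swap: "\<And>z. a z + b (w + z) \<le> c" "\<And>z. a z + b (- w + z) \<le> c"
    and stay: "\<And>z. a z + b z \<le> c'"
  shows "(\<integral>\<^sup>+z. d z * a z \<partial>lborel) + (\<integral>\<^sup>+z. d z * b z \<partial>lborel)
    \<le> 2 * c * (\<integral>\<^sup>+z. h z \<partial>lborel) + c' * (\<integral>\<^sup>+z. r z \<partial>lborel)"
proof -
  have s1: "(\<integral>\<^sup>+z. h (- w + z) * b z \<partial>lborel) = (\<integral>\<^sup>+z. h z * b (w + z) \<partial>lborel)"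
    using nn_integral_lborel_shift[of "\<lambda>z. h (- w + z) * b z" w] by simp
  have s2: "(\<integral>\<^sup>+z. h (- w + z) * b (- w + z) \<partial>lborel) = (\<integral>\<^sup>+z. h z * b z \<partial>lborel)"
    using nn_integral_lborel_shift[of "\<lambda>z. h z * b z" "-w"] by simp
  have s3: "(\<integral>\<^sup>+z. h (- w + z) \<partial>lborel) = (\<integral>\<^sup>+z. h z \<partial>lborel)"
    using nn_integral_lborel_shift[of h "-w"] by simp
  have "(\<integral>\<^sup>+z. d z * a z \<partial>lborel) + (\<integral>\<^sup>+z. d z * b z \<partial>lborel) =
     (\<integral>\<^sup>+z. h z * a z \<partial>lborel) + (\<integral>\<^sup>+z. h (-w+z) * a z \<partial>lborel) + (\<integral>\<^sup>+z. r z * a z \<partial>lborel)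
     + ((\<integral>\<^sup>+z. h z * b z \<partial>lborel) + (\<integral>\<^sup>+z. h (-w+z) * b z \<partial>lborel) + (\<integral>\<^sup>+z. r z * b z \<partial>lborel))"
    by (simp add: d distrib_right nn_integral_add)
  also have "\<dots> = ((\<integral>\<^sup>+z. h z * a z \<partial>lborel) + (\<integral>\<^sup>+z. h z * b (w + z) \<partial>lborel))
     + ((\<integral>\<^sup>+z. h (-w+z) * a z \<partial>lborel) + (\<integral>\<^sup>+z. h (-w+z) * b (-w+z) \<partial>lborel))
     + ((\<integral>\<^sup>+z. r z * a z \<partial>lborel) + (\<integral>\<^sup>+z. r z * b z \<partial>lborel))"
    unfolding s1 s2 by (simp add: ac_simps)
  also have "\<dots> = (\<integral>\<^sup>+z. h z * (a z + b (w + z)) \<partial>lborel)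
     + (\<integral>\<^sup>+z. h (-w+z) * (a z + b (-w+z)) \<partial>lborel) + (\<integral>\<^sup>+z. r z * (a z + b z) \<partial>lborel)"
    by (simp add: distrib_left nn_integral_add)
  also have "\<dots> \<le> (\<integral>\<^sup>+z. h z * c \<partial>lborel) + (\<integral>\<^sup>+z. h (-w+z) * c \<partial>lborel) + (\<integral>\<^sup>+z. r z * c' \<partial>lborel)"
    by (intro add_mono nn_integral_mono mult_left_mono swap stay) auto
  also have "\<dots> = (\<integral>\<^sup>+z. h z \<partial>lborel) * c + (\<integral>\<^sup>+z. h z \<partial>lborel) * c + (\<integral>\<^sup>+z. r z \<partial>lborel) * c'"
    by (subst (1 2 3) nn_integral_multc) (simp_all only: s3, measurable)
  also have "\<dots> = 2 * c * (\<integral>\<^sup>+z. h z \<partial>lborel) + c' * (\<integral>\<^sup>+z. r z \<partial>lborel)"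
    by (subst mult.assoc, subst mult_2) (simp only: mult.commute)
  finally show ?thesis .
qed

section \<open>Exchange of Gaussian mass in the plane\<close>

lemma nn_integral_std_normal_density_exp:
  "(\<integral>\<^sup>+x. ennreal (std_normal_density x * exp (- (x + u)\<^sup>2 / 2)) \<partial>lborel)
    = ennreal (exp (- u\<^sup>2 / 4) / sqrt 2)"
proof -
  have eq: "std_normal_density x * exp (- (x + u)\<^sup>2 / 2)
     = exp (- u\<^sup>2 / 4) / sqrt 2 * normal_density (- u / 2) (1 / sqrt 2) x" for x
  proof -
    have "- x\<^sup>2 / 2 + - (x + u)\<^sup>2 / 2 = - u\<^sup>2 / 4 + (- (x - (- u / 2))\<^sup>2 / (2 * (1 / sqrt 2)\<^sup>2))"
      by (simp add: power2_eq_square field_simps)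
    then have "exp (- x\<^sup>2 / 2) * exp (- (x + u)\<^sup>2 / 2)
       = exp (- u\<^sup>2 / 4) * exp (- (x - (- u / 2))\<^sup>2 / (2 * (1 / sqrt 2)\<^sup>2))"
      unfolding exp_add[symmetric] by (rule arg_cong)
    moreover have "sqrt (2 * pi * (1 / sqrt 2)\<^sup>2) * sqrt 2 = sqrt (2 * pi)"
      by (simp add: real_sqrt_mult power2_eq_square)
    ultimately show ?thesis
      unfolding normal_density_def by (simp add: real_sqrt_mult power_divide)
  qed
  have "(\<integral>\<^sup>+x. ennreal (normal_density (- u / 2) (1 / sqrt 2) x) \<partial>lborel) = 1"
    by (subst nn_integral_eq_integral) auto
  then show ?thesis
    unfolding eq by (subst ennreal_mult') (simp_all add: nn_integral_cmult del: times_divide_eq_left)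
qed

lemma nn_integral_lborel_pair_prod:
  fixes f g :: "real \<Rightarrow> real"
  assumes [measurable]: "f \<in> borel_measurable borel" "g \<in> borel_measurable borel"
    and "\<And>x. 0 \<le> f x" "\<And>x. 0 \<le> g x"
  shows "(\<integral>\<^sup>+z. ennreal (f (fst z) * g (snd z)) \<partial>lborel)
    = (\<integral>\<^sup>+x. ennreal (f x) \<partial>lborel) * (\<integral>\<^sup>+x. ennreal (g x) \<partial>lborel)"
proof -
  have "(\<integral>\<^sup>+z. ennreal (f (fst z) * g (snd z)) \<partial>(lborel \<Otimes>\<^sub>M lborel))
     = (\<integral>\<^sup>+x. \<integral>\<^sup>+y. ennreal (f x * g y) \<partial>lborel \<partial>lborel)"
    by (subst lborel.nn_integral_fst[symmetric]) auto
  then show ?thesis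
    unfolding lborel_prod using assms(3,4)
    by (simp add: ennreal_mult' nn_integral_cmult nn_integral_multc)
qed

lemma std_normal_pair_nn_integral:
  fixes a :: "real \<times> real \<Rightarrow> ennreal"
  assumes [measurable]: "a \<in> borel_measurable borel"
  shows "(\<integral>\<^sup>+x. \<integral>\<^sup>+y. a (x, y) \<partial>std_normal \<partial>std_normal)
    = (\<integral>\<^sup>+z. ennreal (std_normal_density (fst z) * std_normal_density (snd z)) * a z \<partial>lborel)"
proof -
  have [measurable]: "a \<in> borel_measurable (borel \<Otimes>\<^sub>M borel)"
    using assms by (simp add: borel_prod)
  have "(\<integral>\<^sup>+x. \<integral>\<^sup>+y. a (x, y) \<partial>std_normal \<partial>std_normal)
    = (\<integral>\<^sup>+x. \<integral>\<^sup>+y. ennreal (std_normal_density x) * (ennreal (std_normal_density y) * a (x, y)) \<partial>lborel \<partial>lborel)"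
    by (simp add: nn_integral_density nn_integral_cmult)
  also have "\<dots> = (\<integral>\<^sup>+z. ennreal (std_normal_density (fst z) * std_normal_density (snd z)) * a z
       \<partial>(lborel \<Otimes>\<^sub>M lborel))"
    by (subst lborel.nn_integral_fst[symmetric]) (auto simp: ennreal_mult' mult.assoc)
  finally show ?thesis unfolding lborel_prod .
qed

text \<open>The planar Gaussian density splits into a piece \<open>h\<close>, the translate of
  \<open>h\<close> by \<open>(u, - u)\<close>, and a remainder \<open>r\<close>. Exchanging the two
  pieces preserves the law, so \<open>a\<close> may be evaluated at the old point and
  \<open>b\<close> at the new one; \<open>c\<close> governs the moved mass and \<open>c'\<close> the
  rest.\<close>

lemma std_normal_pair_swap_bound:
  fixes a b :: "real \<times> real \<Rightarrow> ennreal"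
  assumes [measurable]: "a \<in> borel_measurable borel" "b \<in> borel_measurable borel"
    and swap: "\<And>x y. a (x, y) + b (x + u, y - u) \<le> ennreal c" "\<And>x y. a (x, y) + b (x - u, y + u) \<le> ennreal c"
    and stay: "\<And>x y. a (x, y) + b (x, y) \<le> ennreal c'"
    and c: "0 \<le> c" "0 \<le> c'"
  shows "(\<integral>\<^sup>+x. \<integral>\<^sup>+y. a (x, y) \<partial>std_normal \<partial>std_normal) + (\<integral>\<^sup>+x. \<integral>\<^sup>+y. b (x, y) \<partial>std_normal \<partial>std_normal)
    \<le> ennreal (c * (exp (- u\<^sup>2 / 2) / 2) + c' * (1 - exp (- u\<^sup>2 / 2) / 2))"
proof -
  \<comment> \<open>Up to a constant, \<open>k u x\<close> is the product of the densities at
    \<open>x\<close> and \<open>x + u\<close>. This symmetric form is what makes a translation by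
    \<open>u\<close> turn it into \<open>k (- u)\<close>.\<close>
  define k where "k u x = std_normal_density x * exp (- (x + u)\<^sup>2 / 2)" for u x :: real
  define d where "d z = ennreal (std_normal_density (fst z) * std_normal_density (snd z))" for z :: "real \<times> real"
  define h where "h z = ennreal (k u (fst z) * k (- u) (snd z) / 2)" for z :: "real \<times> real"
  define r where "r z = ennreal (std_normal_density (fst z) * std_normal_density (snd z) -
     k u (fst z) * k (- u) (snd z) / 2 - k (- u) (fst z) * k u (snd z) / 2)" for z :: "real \<times> real"
  have k0: "0 \<le> k v x" for v x unfolding k_def by simp
  have kle: "k v x \<le> std_normal_density x" for v x
    unfolding k_def by (simp add: mult_left_le)
  \<comment> \<open>Both subtracted terms in \<open>r\<close> are at most half of the full density,
    so the difference there is nonnegative.\<close>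
  have kk: "k v x * k v' y \<le> std_normal_density x * std_normal_density y" for v v' x y
    by (intro mult_mono kle k0) auto
  have [measurable]: "k v \<in> borel_measurable borel" for v unfolding k_def by measurable
  have [measurable]: "h \<in> borel_measurable borel" "r \<in> borel_measurable borel"
    unfolding h_def r_def borel_prod[symmetric] by measurable
  have kshift: "k v (x - v) = k (- v) x" for v x
    unfolding k_def normal_density_def by (simp add: ac_simps)
  have hw: "h (- (u, - u) + z) = ennreal (k (- u) (fst z) * k u (snd z) / 2)" for z
    using kshift[of u "fst z"] kshift[of "- u" "snd z"] unfolding h_def by (simp add: add.commute)
  have dsum: "d z = h z + h (- (u, - u) + z) + r z" for z
    unfolding hw unfolding d_def h_def r_def
    using kk[of u "fst z" "- u" "snd z"] kk[of "- u" "fst z" "u" "snd z"] k0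
    by (simp flip: ennreal_plus)
  have kint: "(\<integral>\<^sup>+x. ennreal (k v x) \<partial>lborel) = ennreal (exp (- v\<^sup>2 / 4) / sqrt 2)" for v
    unfolding k_def by (rule nn_integral_std_normal_density_exp)
  have hint: "(\<integral>\<^sup>+z. h z \<partial>lborel) = ennreal (exp (- u\<^sup>2 / 2) / 4)"
  proof -
    have "(\<integral>\<^sup>+z. h z \<partial>lborel) = (\<integral>\<^sup>+z. ennreal (k u (fst z) * (k (- u) (snd z) / 2)) \<partial>lborel)"
      unfolding h_def by simp
    also have "\<dots> = (\<integral>\<^sup>+x. ennreal (k u x) \<partial>lborel) * (\<integral>\<^sup>+x. ennreal (k (-u) x / 2) \<partial>lborel)"
      by (rule nn_integral_lborel_pair_prod) (auto simp: k0)
    also have "(\<integral>\<^sup>+x. ennreal (k (-u) x / 2) \<partial>lborel) = ennreal (exp (- u\<^sup>2 / 4) / sqrt 2 / 2)"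
    proof -
      have "ennreal (t / 2) = ennreal t / 2" if "0 \<le> t" for t
        using that divide_ennreal[of t 2] by simp
      then show ?thesis using kint[of "- u"] by (simp add: k0 nn_integral_divide del: divide_divide_eq_left)
    qed
    also have "(\<integral>\<^sup>+x. ennreal (k u x) \<partial>lborel) * ennreal (exp (- u\<^sup>2 / 4) / sqrt 2 / 2) = ennreal (exp (- u\<^sup>2 / 2) / 4)"
      unfolding kint by (simp add: field_simps flip: ennreal_mult' exp_add)
    finally show ?thesis .
  qed
  have "(\<integral>\<^sup>+z. d z \<partial>lborel) = 1"
    unfolding d_def by (subst nn_integral_lborel_pair_prod) (auto simp: nn_integral_eq_integral)
  then have "1 = 2 * ennreal (exp (- u\<^sup>2 / 2) / 4) + (\<integral>\<^sup>+z. r z \<partial>lborel)"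
    unfolding dsum using nn_integral_lborel_shift[of h "- (u, - u)"]
    by (simp add: nn_integral_add hint flip: mult_2)
  \<comment> \<open>The remainder carries what the total mass 1 leaves after two pieces of mass
    \<open>exp (- u\<^sup>2 / 2) / 4\<close>.\<close>
  then have rint: "(\<integral>\<^sup>+z. r z \<partial>lborel) = ennreal (1 - exp (- u\<^sup>2 / 2) / 2)"
  proof -
    assume *: "1 = 2 * ennreal (exp (- u\<^sup>2 / 2) / 4) + (\<integral>\<^sup>+z. r z \<partial>lborel)"
    have "2 * ennreal (exp (- u\<^sup>2 / 2) / 4) = ennreal (exp (- u\<^sup>2 / 2) / 2)"
      by (simp flip: ennreal_numeral ennreal_mult')
    with * have "(\<integral>\<^sup>+z. r z \<partial>lborel) = ennreal 1 - ennreal (exp (- u\<^sup>2 / 2) / 2)"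
      by (metis ennreal_1 ennreal_add_diff_cancel_left ennreal_neq_top)
    then show ?thesis using ennreal_minus[of "exp (- u\<^sup>2 / 2) / 2" 1] by simp
  qed
  have "(\<integral>\<^sup>+z. d z * a z \<partial>lborel) + (\<integral>\<^sup>+z. d z * b z \<partial>lborel)
     \<le> 2 * ennreal c * (\<integral>\<^sup>+z. h z \<partial>lborel) + ennreal c' * (\<integral>\<^sup>+z. r z \<partial>lborel)"
  proof (rule swap_mass_bound[where w = "(u, - u)" and d = d, OF _ _ _ _ dsum])
    show "a z + b ((u, - u) + z) \<le> ennreal c" for z
      using swap(1)[of "fst z" "snd z"] by (cases z) (simp add: ac_simps)
    show "a z + b (- (u, - u) + z) \<le> ennreal c" for z
      using swap(2)[of "fst z" "snd z"] by (cases z) (simp add: ac_simps)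
    show "a z + b z \<le> ennreal c'" for z
      using stay[of "fst z" "snd z"] by simp
  qed measurable
  also have "\<dots> = ennreal (c * (exp (- u\<^sup>2 / 2) / 2) + c' * (1 - exp (- u\<^sup>2 / 2) / 2))"
  proof -
    have "exp (- u\<^sup>2 / 2) \<le> 1" by simp
    then have "0 \<le> 1 - exp (- u\<^sup>2 / 2) / 2" by linarith
    then have "ennreal (c * (exp (- u\<^sup>2 / 2) / 2) + c' * (1 - exp (- u\<^sup>2 / 2) / 2))
       = ennreal (2 * c * (exp (- u\<^sup>2 / 2) / 4)) + ennreal (c' * (1 - exp (- u\<^sup>2 / 2) / 2))"
      using c by (subst ennreal_plus[symmetric]) auto
    also have "\<dots> = 2 * ennreal c * ennreal (exp (- u\<^sup>2 / 2) / 4) + ennreal c' * ennreal (1 - exp (- u\<^sup>2 / 2) / 2)"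
    proof -
      have "ennreal (2 * c * t) = 2 * ennreal c * ennreal t" if "0 \<le> t" for t
        using c that by (simp add: ennreal_mult)
      moreover have "ennreal (c' * t) = ennreal c' * ennreal t" if "0 \<le> t" for t
        using c that by (simp add: ennreal_mult)
      ultimately show ?thesis using \<open>0 \<le> 1 - exp (- u\<^sup>2 / 2) / 2\<close> by (metis divide_nonneg_pos exp_ge_zero zero_less_numeral)
    qed
    finally show ?thesis unfolding hint rint ..
  qed
  finally show ?thesis
    unfolding d_def by (simp add: std_normal_pair_nn_integral)
qed

section \<open>Matchings and repeated attempts\<close>

text \<open>Only the multiset of values is prescribed: where the pairs \<open>u, - u\<close> sit is
  irrelevant to a permutation invariant set, and the random swaps do not control it. Comparing sizes
  shows that the subtraction never truncates for finite \<open>I\<close>.\<close>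

definition matching :: "nat set \<Rightarrow> real multiset \<Rightarrow> (nat \<Rightarrow> real) \<Rightarrow> bool" where
  "matching I M v \<longleftrightarrow>
     image_mset v (mset_set I) = M + image_mset uminus M + replicate_mset (card I - 2 * size M) 0"

text \<open>An attempt at \<open>u\<close> succeeds with probability
  \<open>exp (- u\<^sup>2 / 2) / 2\<close>; the summand is the mean waiting time.\<close>

definition swap_cost :: "real multiset \<Rightarrow> real" where
  "swap_cost M = (\<Sum>u\<in>#M. 2 * exp (u\<^sup>2 / 2))"

lemma swap_cost_add_mset: "swap_cost (add_mset u M) = 2 * exp (u\<^sup>2 / 2) + swap_cost M"
  by (simp add: swap_cost_def)

lemma swap_cost_nonneg: "0 \<le> swap_cost M"
  unfolding swap_cost_def by (induction M) auto

lemma matching_empty: "matching I {#} (\<lambda>_. 0)"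
  by (simp add: matching_def image_mset_const_eq)

lemma matching_size:
  assumes "finite I" "matching I M v"
  shows "2 * size M \<le> card I"
  using arg_cong[of _ _ size, OF assms(2)[unfolded matching_def]] assms(1) by simp

lemma image_mset_fun_upd_outside:
  "finite I \<Longrightarrow> i \<notin> I \<Longrightarrow> image_mset (f(i := y)) (mset_set I) = image_mset f (mset_set I)"
  by (intro image_mset_cong) auto

text \<open>These are the three outcomes of an attempt at \<open>u\<close> on the coordinates
  \<open>i\<close> and \<open>j\<close>: a move in either direction, or none, in which case
  \<open>u\<close> is not yet placed.\<close>

lemma matching_insert_pair:
  assumes "finite I" "i \<noteq> j" "i \<notin> I" "j \<notin> I" "matching I M v"
  shows "matching (insert i (insert j I)) (add_mset u M) (v(j := - u, i := u))"
    and "matching (insert i (insert j I)) (add_mset u M) (v(j := u, i := - u))"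
    and "matching (insert i (insert j I)) M (v(j := 0, i := 0))"
  using assms matching_size[OF assms(1,5)] unfolding matching_def
  by (auto simp: image_mset_fun_upd_outside Suc_diff_le)

lemma borel_measurable_two_updates:
  fixes F :: "(nat \<Rightarrow> real) \<Rightarrow> ennreal"
  assumes [measurable]: "F \<in> borel_measurable (PiM (insert i (insert j I)) (\<lambda>_. std_normal))"
    and fin: "finite I"
  shows "(\<lambda>w. F (w(j := t, i := s))) \<in> borel_measurable (PiM I (\<lambda>_. std_normal))"
    and "(\<lambda>p. \<integral>\<^sup>+w. F (w(j := snd p, i := fst p)) \<partial>PiM I (\<lambda>_. std_normal)) \<in> borel_measurable borel"
proof -
  interpret product_sigma_finite "\<lambda>_::nat. std_normal"
    by (intro product_sigma_finite.intro prob_space_imp_sigma_finite prob_space_normal_density) simp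
  interpret finite_product_sigma_finite "\<lambda>_::nat. std_normal" I
    by standard fact
  have *: "(\<lambda>q. (snd q)(j := snd (fst q), i := fst (fst q))) \<in>
      measurable ((borel \<Otimes>\<^sub>M borel) \<Otimes>\<^sub>M PiM I (\<lambda>_. std_normal)) (PiM (insert i (insert j I)) (\<lambda>_. std_normal))"
    by (intro measurable_fun_upd[where J = "insert j I"] measurable_fun_upd[where J = I]) auto
  have "(\<lambda>q. F ((snd q)(j := snd (fst q), i := fst (fst q)))) \<in>
      borel_measurable ((borel \<Otimes>\<^sub>M borel) \<Otimes>\<^sub>M PiM I (\<lambda>_. std_normal))"
    using measurable_compose[OF * assms(1)] .
  from borel_measurable_nn_integral_fst[OF this]
  show "(\<lambda>p. \<integral>\<^sup>+w. F (w(j := snd p, i := fst p)) \<partial>PiM I (\<lambda>_. std_normal)) \<in> borel_measurable borel"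
    by (simp add: borel_prod)
  have "(\<lambda>w. w(j := t, i := s)) \<in> measurable (PiM I (\<lambda>_. std_normal)) (PiM (insert i (insert j I)) (\<lambda>_. std_normal))"
    by (intro measurable_fun_upd[where J = "insert j I"] measurable_fun_upd[where J = I]) auto
  from measurable_compose[OF this assms(1)]
  show "(\<lambda>w. F (w(j := t, i := s))) \<in> borel_measurable (PiM I (\<lambda>_. std_normal))" .
qed

lemma nn_integral_PiM_insert_pair:
  fixes F :: "(nat \<Rightarrow> real) \<Rightarrow> ennreal"
  assumes F[measurable]: "F \<in> borel_measurable (PiM (insert i (insert j I)) (\<lambda>_. std_normal))"
    and fin: "finite I" and ij: "i \<noteq> j" "i \<notin> I" "j \<notin> I"
  shows "(\<integral>\<^sup>+w. F w \<partial>PiM (insert i (insert j I)) (\<lambda>_. std_normal)) =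
    (\<integral>\<^sup>+s. \<integral>\<^sup>+t. \<integral>\<^sup>+w. F (w(j := t, i := s)) \<partial>PiM I (\<lambda>_. std_normal) \<partial>std_normal \<partial>std_normal)"
proof -
  interpret product_sigma_finite "\<lambda>_::nat. std_normal"
    by (intro product_sigma_finite.intro prob_space_imp_sigma_finite prob_space_normal_density) simp
  have "(\<lambda>w. w(i := s)) \<in> measurable (PiM (insert j I) (\<lambda>_. std_normal)) (PiM (insert i (insert j I)) (\<lambda>_. std_normal))" for s
    by (intro measurable_fun_upd[where J = "insert j I"]) auto
  from measurable_compose[OF this F]
  have [measurable]: "(\<lambda>w. F (w(i := s))) \<in> borel_measurable (PiM (insert j I) (\<lambda>_. std_normal))" for s .
  show ?thesis
    using fin ij by (simp add: product_nn_integral_insert_rev)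
qed

lemma nn_integral_std_normal_le:
  assumes "\<And>x. x \<in> space (PiM I (\<lambda>_. std_normal)) \<Longrightarrow> F x \<le> c"
  shows "(\<integral>\<^sup>+x. F x \<partial>PiM I (\<lambda>_. std_normal)) \<le> c"
proof -
  interpret prob_space "PiM I (\<lambda>_. std_normal)"
    by (intro prob_space_PiM prob_space_normal_density) simp
  show ?thesis
    using nn_integral_mono[of "PiM I (\<lambda>_. std_normal)" F "\<lambda>_. c"] assms by (simp add: emeasure_space_1)
qed

lemma matching_empty_bound:
  assumes [measurable]: "F \<in> borel_measurable (PiM I (\<lambda>_. std_normal))" "G \<in> borel_measurable (PiM I (\<lambda>_. std_normal))"
    and swap: "\<And>x v. x \<in> space (PiM I (\<lambda>_. std_normal)) \<Longrightarrow> matching I {#} v \<Longrightarrow>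
           F x + G (\<lambda>i\<in>I. x i + v i) \<le> 1"
  shows "(\<integral>\<^sup>+x. F x \<partial>PiM I (\<lambda>_. std_normal)) + (\<integral>\<^sup>+x. G x \<partial>PiM I (\<lambda>_. std_normal)) \<le> 1"
proof -
  have "F x + G x \<le> 1" if x: "x \<in> space (PiM I (\<lambda>_. std_normal))" for x
    using swap[OF x, of "\<lambda>_. 0"] x
    by (simp add: matching_empty space_PiM PiE_def extensional_restrict)
  then have "(\<integral>\<^sup>+x. F x + G x \<partial>PiM I (\<lambda>_. std_normal)) \<le> 1"
    by (rule nn_integral_std_normal_le)
  then show ?thesis by (simp add: nn_integral_add)
qed

text \<open>The right-hand side is \<open>1\<close> plus the Markov bound for the probability that \<open>N\<close> pairs of coordinates
  do not suffice to place all elements of \<open>M\<close>. The induction is on the number of pairs left; a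
  successful attempt removes an element from \<open>M\<close>.\<close>

lemma matching_swap_bound:
  assumes "finite I" "2 * N \<le> card I"
    and "F \<in> borel_measurable (PiM I (\<lambda>_. std_normal))" "G \<in> borel_measurable (PiM I (\<lambda>_. std_normal))"
    and "\<And>x. F x \<le> 1" "\<And>x. G x \<le> 1"
    and "\<And>x v. x \<in> space (PiM I (\<lambda>_. std_normal)) \<Longrightarrow> matching I M v \<Longrightarrow>
           F x + G (\<lambda>i\<in>I. x i + v i) \<le> 1"
  shows "(\<integral>\<^sup>+x. F x \<partial>PiM I (\<lambda>_. std_normal)) + (\<integral>\<^sup>+x. G x \<partial>PiM I (\<lambda>_. std_normal))
    \<le> ennreal (1 + swap_cost M / (real N + 1))"
  using assms
proof (induction N arbitrary: I M F G)
  case (0 I M F G)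
  show ?case
  proof (cases M)
    case empty
    then show ?thesis
      using matching_empty_bound[OF "0.prems"(3,4)] "0.prems"(7) by (simp add: swap_cost_def)
  next
    case (add u M')
    \<comment> \<open>With no attempt left and something still to place, only the trivial bound 2 is
      available; it suffices because a single element already costs at least 2.\<close>
    have "(\<integral>\<^sup>+x. F x \<partial>PiM I (\<lambda>_. std_normal)) + (\<integral>\<^sup>+x. G x \<partial>PiM I (\<lambda>_. std_normal)) \<le> 1 + 1"
      by (intro add_mono nn_integral_std_normal_le "0.prems")
    also have "\<dots> \<le> ennreal (1 + swap_cost M)"
    proof -
      have "1 \<le> exp (u\<^sup>2 / 2)" by simp
      then have "2 \<le> 1 + swap_cost M"
        unfolding add swap_cost_add_mset using swap_cost_nonneg[of M'] by linarith
      then have "ennreal 2 \<le> ennreal (1 + swap_cost M)" by (rule ennreal_leI)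
      then show ?thesis by (simp only: one_add_one ennreal_numeral)
    qed
    finally show ?thesis by simp
  qed
next
  case (Suc N I M F G)
  have "(\<integral>\<^sup>+x. F x \<partial>PiM I (\<lambda>_. std_normal)) + (\<integral>\<^sup>+x. G x \<partial>PiM I (\<lambda>_. std_normal)) \<le> 1 + 1"
    by (intro add_mono nn_integral_std_normal_le Suc.prems)
  then have triv: "(\<integral>\<^sup>+x. F x \<partial>PiM I (\<lambda>_. std_normal)) + (\<integral>\<^sup>+x. G x \<partial>PiM I (\<lambda>_. std_normal)) \<le> ennreal 2"
    by simp
  obtain i where i: "i \<in> I" using Suc.prems(2) by fastforce
  have "0 < card (I - {i})" using Suc.prems(1,2) i by simp
  then obtain j where j: "j \<in> I - {i}" by (auto simp: card_gt_0_iff)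
  define J where "J = I - {i, j}"
  have I: "I = insert i (insert j J)" and J: "finite J" "i \<noteq> j" "i \<notin> J" "j \<notin> J"
    using i j Suc.prems(1) by (auto simp: J_def)
  have cJ: "2 * N \<le> card J" using Suc.prems(2) J unfolding I by simp
  show ?case
  proof (cases M)
    case empty
    then show ?thesis
      using matching_empty_bound[OF Suc.prems(3,4)] Suc.prems(7) by (simp add: swap_cost_def)
  next
    case (add u M')
    note F = Suc.prems(3)[unfolded I] and G = Suc.prems(4)[unfolded I]
    define a where "a p = (\<integral>\<^sup>+w. F (w(j := snd p, i := fst p)) \<partial>PiM J (\<lambda>_. std_normal))" for p
    define b where "b p = (\<integral>\<^sup>+w. G (w(j := snd p, i := fst p)) \<partial>PiM J (\<lambda>_. std_normal))" for p
    have ab: "a \<in> borel_measurable borel" "b \<in> borel_measurable borel"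
      unfolding a_def b_def by (rule borel_measurable_two_updates(2)[OF F J(1)] borel_measurable_two_updates(2)[OF G J(1)])+
    have IH: "a (s, t) + b (s + s', t + t') \<le> ennreal (1 + swap_cost M'' / (real N + 1))"
      if *: "\<And>v. matching J M'' v \<Longrightarrow> matching I M (v(j := t', i := s'))" for s t s' t' M''
      unfolding a_def b_def fst_conv snd_conv
    proof (rule Suc.IH[OF J(1) cJ borel_measurable_two_updates(1)[OF F J(1)] borel_measurable_two_updates(1)[OF G J(1)]])
      fix w v assume w: "w \<in> space (PiM J (\<lambda>_. std_normal))" and v: "matching J M'' v"
      have "F (w(j := t, i := s)) + G (\<lambda>k\<in>I. (w(j := t, i := s)) k + (v(j := t', i := s')) k) \<le> 1"
        by (rule Suc.prems(7)[OF _ *[OF v]]) (use w in \<open>auto simp: I space_PiM PiE_def extensional_def\<close>)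
      also have "(\<lambda>k\<in>I. (w(j := t, i := s)) k + (v(j := t', i := s')) k) = (\<lambda>k\<in>J. w k + v k)(j := t + t', i := s + s')"
        using J by (auto simp: I fun_eq_iff)
      finally show "F (w(j := t, i := s)) + G ((\<lambda>k\<in>J. w k + v k)(j := t + t', i := s + s')) \<le> 1" .
    qed (rule Suc.prems)+
    let ?E = "swap_cost M" and ?p = "exp (- u\<^sup>2 / 2) / 2"
    have E: "?E = 2 * exp (u\<^sup>2 / 2) + swap_cost M'" by (simp add: add swap_cost_add_mset)
    show ?thesis
    \<comment> \<open>The recursion yields \<open>1 + (?E - 1) / (N + 1)\<close>, which is at most
      the desired \<open>1 + ?E / (N + 2)\<close> exactly when \<open>?E \<le> N + 2\<close>.
      Otherwise the desired bound is at least 2 and nothing needs proof.\<close>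
    proof (cases "?E \<le> real N + 2")
      case True
      have "(\<integral>\<^sup>+x. F x \<partial>PiM I (\<lambda>_. std_normal)) + (\<integral>\<^sup>+x. G x \<partial>PiM I (\<lambda>_. std_normal))
         = (\<integral>\<^sup>+x. \<integral>\<^sup>+y. a (x, y) \<partial>std_normal \<partial>std_normal) + (\<integral>\<^sup>+x. \<integral>\<^sup>+y. b (x, y) \<partial>std_normal \<partial>std_normal)"
        unfolding I nn_integral_PiM_insert_pair[OF F J] nn_integral_PiM_insert_pair[OF G J] a_def b_def by simp
      also have "\<dots> \<le> ennreal ((1 + swap_cost M' / (real N + 1)) * ?p + (1 + ?E / (real N + 1)) * (1 - ?p))"
      proof (rule std_normal_pair_swap_bound[OF ab])
        show "a (x, y) + b (x + u, y - u) \<le> ennreal (1 + swap_cost M' / (real N + 1))" for x y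
          using IH[of M' "- u" u x y] matching_insert_pair(1)[OF J] by (simp add: I add)
        show "a (x, y) + b (x - u, y + u) \<le> ennreal (1 + swap_cost M' / (real N + 1))" for x y
          using IH[of M' "u" "- u" x y] matching_insert_pair(2)[OF J] by (simp add: I add)
        show "a (x, y) + b (x, y) \<le> ennreal (1 + ?E / (real N + 1))" for x y
          using IH[of M 0 0 x y] matching_insert_pair(3)[OF J] by (simp add: I)
      qed (use swap_cost_nonneg in auto)
      also have "\<dots> \<le> ennreal (1 + ?E / (real (Suc N) + 1))"
      proof (rule ennreal_leI)
        \<comment> \<open>Success probability times mean waiting time is 1, so one attempt lowers
          the expected cost by exactly 1.\<close>
        have p: "?p * (2 * exp (u\<^sup>2 / 2)) = 1" by (simp add: exp_minus field_simps)
        have "(1 + swap_cost M' / (real N + 1)) * ?p + (1 + ?E / (real N + 1)) * (1 - ?p)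
           = 1 + (?E - ?p * (2 * exp (u\<^sup>2 / 2))) / (real N + 1)"
        proof -
          have "(1 + s / D) * p + (1 + (e + s) / D) * (1 - p) = 1 + ((e + s) - p * e) / D" if "D \<noteq> 0" for s D e p :: real
            using that by (simp add: field_simps)
          from this[of "real N + 1" "swap_cost M'" ?p "2 * exp (u\<^sup>2 / 2)"] show ?thesis
            unfolding E by linarith
        qed
        also have "\<dots> = 1 + (?E - 1) / (real N + 1)" unfolding p ..
        also have "\<dots> \<le> 1 + ?E / (real (Suc N) + 1)"
          using True by (simp add: field_simps)
        finally show "(1 + swap_cost M' / (real N + 1)) * ?p + (1 + ?E / (real N + 1)) * (1 - ?p) \<le> 1 + ?E / (real (Suc N) + 1)" .
      qed
      finally show ?thesis .
    next
      case False
      then have "2 \<le> 1 + ?E / (real (Suc N) + 1)" by (simp add: field_simps)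
      with triv show ?thesis by (meson ennreal_leI order_trans)
    qed
  qed
qed

subsection \<open>Gaussian measure of reflected translates\<close>

text \<open>This is the Cameron-Martin density: the Gaussian measure translated by \<open>z\<close>,
  relative to the Gaussian measure.\<close>

definition shift_density :: "nat set \<Rightarrow> (nat \<Rightarrow> real) \<Rightarrow> (nat \<Rightarrow> real) \<Rightarrow> real" where
  "shift_density I z x = (\<Prod>i\<in>I. exp (z i * x i - (z i)\<^sup>2 / 2))"

lemma borel_measurable_shift_density [measurable]:
  "shift_density I z \<in> borel_measurable (PiM I (\<lambda>_. std_normal))"
  unfolding shift_density_def[abs_def] by measurable

lemma distr_std_normal_reflect:
  "distr std_normal borel (\<lambda>x. z - x) = density std_normal (\<lambda>x. ennreal (exp (z * x - z\<^sup>2 / 2)))"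
proof (rule measure_eqI)
  fix A assume "A \<in> sets (distr std_normal borel (\<lambda>x. z - x))"
  then have [measurable]: "A \<in> sets borel" by simp
  have d: "std_normal_density (z - y) = std_normal_density y * exp (z * y - z\<^sup>2 / 2)" for y
  proof -
    have "- (z - y)\<^sup>2 / 2 = - y\<^sup>2 / 2 + (z * y - z\<^sup>2 / 2)"
      by (simp add: power2_eq_square field_simps)
    then have "exp (- (z - y)\<^sup>2 / 2) = exp (- y\<^sup>2 / 2) * exp (z * y - z\<^sup>2 / 2)"
      by (simp only: exp_add)
    then show ?thesis unfolding std_normal_density_def by simp
  qed
  have "emeasure (distr std_normal borel (\<lambda>x. z - x)) A
     = (\<integral>\<^sup>+x. ennreal (std_normal_density x) * indicator A (z - x) \<partial>lborel)"
  proof -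
    have [measurable]: "(\<lambda>x. z - x) -` A \<in> sets borel"
      using measurable_sets[of "\<lambda>x. z - x" borel borel A] by simp
    have "emeasure (distr std_normal borel (\<lambda>x. z - x)) A = emeasure std_normal ((\<lambda>x. z - x) -` A)"
      by (subst emeasure_distr) auto
    also have "\<dots> = (\<integral>\<^sup>+x. ennreal (std_normal_density x) * indicator A (z - x) \<partial>lborel)"
      by (subst emeasure_density) (auto intro!: nn_integral_cong split: split_indicator)
    finally show ?thesis .
  qed
  also have "\<dots> = (\<integral>\<^sup>+y. ennreal (std_normal_density (z - y)) * indicator A y \<partial>lborel)"
    by (subst nn_integral_real_affine[where c = "- 1" and t = z]) auto
  also have "\<dots> = emeasure (density std_normal (\<lambda>x. ennreal (exp (z * x - z\<^sup>2 / 2)))) A"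
    by (simp add: emeasure_density nn_integral_density d ennreal_mult' mult.assoc)
  finally show "emeasure (distr std_normal borel (\<lambda>x. z - x)) A
     = emeasure (density std_normal (\<lambda>x. ennreal (exp (z * x - z\<^sup>2 / 2)))) A" .
qed simp

lemma prob_space_std_normal_tilt:
  "prob_space (density std_normal (\<lambda>x. ennreal (exp (z * x - z\<^sup>2 / 2))))"
  unfolding distr_std_normal_reflect[symmetric]
  by (intro prob_space.prob_space_distr prob_space_normal_density) simp_all

text \<open>Both sides are the product of the one-dimensional tilted laws \<open>M i\<close>, which
  is checked on boxes.\<close>

lemma distr_PiM_std_normal_reflect:
  assumes fin: "finite I"
  shows "distr (PiM I (\<lambda>_. std_normal)) (PiM I (\<lambda>_. std_normal)) (\<lambda>x. \<lambda>i\<in>I. z i - x i)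
     = density (PiM I (\<lambda>_. std_normal)) (\<lambda>x. ennreal (shift_density I z x))"
    (is "?L = ?R")
proof -
  define M where "M i = density std_normal (\<lambda>x. ennreal (exp (z i * x - (z i)\<^sup>2 / 2)))" for i
  interpret M: product_sigma_finite M
    by (intro product_sigma_finite.intro prob_space_imp_sigma_finite) (simp add: M_def prob_space_std_normal_tilt)
  interpret product_sigma_finite "\<lambda>_::nat. std_normal"
    by (intro product_sigma_finite.intro prob_space_imp_sigma_finite prob_space_normal_density) simp
  have sets_M: "sets (PiM I M) = sets (PiM I (\<lambda>_. std_normal))"
    by (intro sets_PiM_cong) (auto simp: M_def)
  have "?L = PiM I M"
  proof (rule M.PiM_eqI[OF fin])
    fix A assume "\<And>i. i \<in> I \<Longrightarrow> A i \<in> sets (M i)"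
    then have A [measurable]: "\<And>i. i \<in> I \<Longrightarrow> A i \<in> sets borel" by (simp add: M_def)
    have [measurable]: "PiE I A \<in> sets (PiM I (\<lambda>_. std_normal))"
      using fin A by (intro sets_PiM_I_finite) auto
    have "emeasure ?L (PiE I A) = emeasure (PiM I (\<lambda>_. std_normal)) (PiE I (\<lambda>i. (\<lambda>x. z i - x) -` A i))"
    proof -
      have "emeasure ?L (PiE I A) = emeasure (PiM I (\<lambda>_. std_normal))
          ((\<lambda>x. \<lambda>i\<in>I. z i - x i) -` PiE I A \<inter> space (PiM I (\<lambda>_. std_normal)))"
        by (rule emeasure_distr) measurable
      also have "(\<lambda>x. \<lambda>i\<in>I. z i - x i) -` PiE I A \<inter> space (PiM I (\<lambda>_. std_normal)) =
          PiE I (\<lambda>i. (\<lambda>x. z i - x) -` A i)"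
        by (auto simp: space_PiM PiE_def Pi_def extensional_def)
      finally show ?thesis .
    qed
    also have "\<dots> = (\<Prod>i\<in>I. emeasure std_normal ((\<lambda>x. z i - x) -` A i))"
    proof (rule emeasure_PiM[OF fin])
      show "(\<lambda>x. z i - x) -` A i \<in> sets std_normal" if "i \<in> I" for i
        using measurable_sets[of "\<lambda>x. z i - x" borel borel "A i"] A[OF that] by simp
    qed
    also have "\<dots> = (\<Prod>i\<in>I. emeasure (M i) (A i))"
      using A unfolding M_def distr_std_normal_reflect[symmetric]
      by (intro prod.cong refl) (simp add: emeasure_distr)
    finally show "emeasure ?L (PiE I A) = (\<Prod>i\<in>I. emeasure (M i) (A i))" .
  qed (simp add: sets_M)
  moreover have "?R = PiM I M"
  proof (rule M.PiM_eqI[OF fin])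
    fix A assume "\<And>i. i \<in> I \<Longrightarrow> A i \<in> sets (M i)"
    then have A [measurable]: "\<And>i. i \<in> I \<Longrightarrow> A i \<in> sets borel" by (simp add: M_def)
    have [measurable]: "PiE I A \<in> sets (PiM I (\<lambda>_. std_normal))"
      using fin A by (intro sets_PiM_I_finite) auto
    have "emeasure ?R (PiE I A) = (\<integral>\<^sup>+x. ennreal (shift_density I z x) * indicator (PiE I A) x \<partial>PiM I (\<lambda>_. std_normal))"
      by (subst emeasure_density) auto
    also have "\<dots> = (\<integral>\<^sup>+x. (\<Prod>i\<in>I. ennreal (exp (z i * x i - (z i)\<^sup>2 / 2)) * indicator (A i) (x i)) \<partial>PiM I (\<lambda>_. std_normal))"
    proof (rule nn_integral_cong)
      fix x assume "x \<in> space (PiM I (\<lambda>_. std_normal))"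
      then have "indicator (PiE I A) x = (\<Prod>i\<in>I. indicator (A i) (x i) :: ennreal)"
        using fin by (auto simp: space_PiM PiE_def Pi_def split: split_indicator)
      then show "ennreal (shift_density I z x) * indicator (PiE I A) x =
          (\<Prod>i\<in>I. ennreal (exp (z i * x i - (z i)\<^sup>2 / 2)) * indicator (A i) (x i))"
        by (simp add: shift_density_def prod.distrib prod_ennreal)
    qed
    also have "\<dots> = (\<Prod>i\<in>I. \<integral>\<^sup>+x. ennreal (exp (z i * x - (z i)\<^sup>2 / 2)) * indicator (A i) x \<partial>std_normal)"
      using fin by (intro product_nn_integral_prod) auto
    also have "\<dots> = (\<Prod>i\<in>I. emeasure (M i) (A i))"
      unfolding M_def by (intro prod.cong refl) (auto simp: emeasure_density)
    finally show "emeasure ?R (PiE I A) = (\<Prod>i\<in>I. emeasure (M i) (A i))" .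
  qed (simp add: sets_M)
  ultimately show ?thesis by simp
qed

lemma nn_integral_shift_density:
  assumes "finite I"
  shows "(\<integral>\<^sup>+x. ennreal (shift_density I z x) \<partial>PiM I (\<lambda>_. std_normal)) = 1"
proof -
  interpret prob_space "PiM I (\<lambda>_. std_normal)"
    by (intro prob_space_PiM prob_space_normal_density) simp
  have "prob_space (density (PiM I (\<lambda>_. std_normal)) (\<lambda>x. ennreal (shift_density I z x)))"
    unfolding distr_PiM_std_normal_reflect[OF assms, symmetric]
    by (rule prob_space_distr) measurable
  from prob_space.emeasure_space_1[OF this] show ?thesis
    by (simp add: emeasure_density cong: nn_integral_cong)
qed

text \<open>Since the density on the right has total mass 1, this identity computes the second
  moment of \<open>shift_density I z\<close>.\<close>

lemma shift_density_square:
  "(shift_density I z x)\<^sup>2 = exp (\<Sum>i\<in>I. (z i)\<^sup>2) * shift_density I (\<lambda>i. 2 * z i) x"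
proof (cases "finite I")
  case True
  have *: "(exp (z i * x i - (z i)\<^sup>2 / 2))\<^sup>2 = exp ((z i)\<^sup>2) * exp (2 * z i * x i - (2 * z i)\<^sup>2 / 2)" for i
    unfolding exp_add[symmetric] exp_double[symmetric] by (simp add: power2_eq_square algebra_simps)
  show ?thesis
    unfolding shift_density_def prod_power_distrib exp_sum[OF True] prod.distrib[symmetric] * ..
qed (simp add: shift_density_def)

text \<open>The loss is at most the mean of \<open>1 - L\<close> over \<open>A\<close>, where
  \<open>L\<close> is the translated density. It is controlled by the variance of \<open>L\<close>,
  which equals \<open>exp (\<Sum>i\<in>I. (z i)\<^sup>2) - 1\<close>.\<close>

lemma prob_reflect_ge:
  fixes I :: "nat set"
  assumes fin: "finite I" and A[measurable]: "A \<in> sets (PiM I (\<lambda>_. std_normal))"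
    and z: "(\<Sum>i\<in>I. (z i)\<^sup>2) \<le> 1 / 25"
  shows "measure (PiM I (\<lambda>_. std_normal)) A - 1 / 4
     \<le> measure (PiM I (\<lambda>_. std_normal)) {x \<in> space (PiM I (\<lambda>_. std_normal)). (\<lambda>i\<in>I. z i - x i) \<in> A}"
proof -
  let ?P = "PiM I (\<lambda>_. std_normal)" and ?L = "shift_density I z"
  interpret prob_space ?P
    by (intro prob_space_PiM prob_space_normal_density) simp
  have L0: "0 \<le> shift_density I y x" for x y
    unfolding shift_density_def by (intro prod_nonneg) simp
  have Li: "integrable ?P (shift_density I y)" "integral\<^sup>L ?P (shift_density I y) = 1" for y
    using nn_integral_shift_density[OF fin, of y] L0
    by (auto intro!: integrableI_nonneg simp: integral_eq_nn_integral)
  have L2i: "integrable ?P (\<lambda>x. (?L x)\<^sup>2)"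
    unfolding shift_density_square using Li by simp
  have L2: "integral\<^sup>L ?P (\<lambda>x. (?L x)\<^sup>2) = exp (\<Sum>i\<in>I. (z i)\<^sup>2)"
    unfolding shift_density_square using Li by simp
  have ALi: "integrable ?P (\<lambda>x. indicator A x * ?L x)"
    using integrable_real_mult_indicator[OF A Li(1)] by (simp add: mult.commute)
  have Ai: "integrable ?P (indicator A :: _ \<Rightarrow> real)"
    by (simp add: integrable_indicator_iff less_top[symmetric])
  \<comment> \<open>An elementary substitute for the Cauchy-Schwarz inequality:
    \<open>d \<le> 1 / 8 + 2 * d\<^sup>2\<close> with \<open>d = 1 - ?L x\<close>.\<close>
  have *: "indicator A x - indicator A x * ?L x \<le> 1 / 8 + 2 * ((?L x)\<^sup>2 - 2 * ?L x + 1)" for x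
  proof -
    have "1 - ?L x \<le> 1 / 8 + 2 * ((?L x)\<^sup>2 - 2 * ?L x + 1)"
      using zero_le_power2[of "4 * (1 - ?L x) - 1"] by (simp add: power2_eq_square algebra_simps)
    moreover have "0 \<le> 1 / 8 + 2 * ((?L x)\<^sup>2 - 2 * ?L x + 1)"
      using zero_le_power2[of "1 - ?L x"] by (simp add: power2_eq_square algebra_simps)
    ultimately show ?thesis by (simp split: split_indicator)
  qed
  have "measure ?P {x \<in> space ?P. (\<lambda>i\<in>I. z i - x i) \<in> A} = measure (distr ?P ?P (\<lambda>x. \<lambda>i\<in>I. z i - x i)) A"
    by (subst measure_distr) (auto intro!: arg_cong2[where f = measure])
  also have "\<dots> = integral\<^sup>L ?P (\<lambda>x. indicator A x * ?L x)"
  proof -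
    have "emeasure (density ?P (\<lambda>x. ennreal (?L x))) A = (\<integral>\<^sup>+x. ennreal (indicator A x * ?L x) \<partial>?P)"
      by (subst emeasure_density) (auto intro!: nn_integral_cong split: split_indicator)
    then show ?thesis
      unfolding distr_PiM_std_normal_reflect[OF fin] measure_def
      using L0 by (subst integral_eq_nn_integral) auto
  qed
  finally have m: "measure ?P {x \<in> space ?P. (\<lambda>i\<in>I. z i - x i) \<in> A} = integral\<^sup>L ?P (\<lambda>x. indicator A x * ?L x)" .
  have "measure ?P A - integral\<^sup>L ?P (\<lambda>x. indicator A x * ?L x) = integral\<^sup>L ?P (\<lambda>x. indicator A x - indicator A x * ?L x)"
    using ALi by (subst Bochner_Integration.integral_diff) (auto simp: integrable_indicator_iff less_top[symmetric])
  also have "\<dots> \<le> integral\<^sup>L ?P (\<lambda>x. 1 / 8 + 2 * ((?L x)\<^sup>2 - 2 * ?L x + 1))"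
    using * ALi L2i Li Ai by (intro integral_mono) auto
  also have "\<dots> = 1 / 8 + 2 * (exp (\<Sum>i\<in>I. (z i)\<^sup>2) - 1)"
    using L2i Li L2 by (simp add: prob_space)
  also have "\<dots> \<le> 1 / 4"
  proof -
    have "exp (\<Sum>i\<in>I. (z i)\<^sup>2) \<le> exp (1 / 25)" using z by simp
    also have "\<dots> \<le> 1 + 1 / 25 + (1 / 25)\<^sup>2" by (rule exp_bound) auto
    finally show ?thesis by (simp add: power2_eq_square)
  qed
  finally show ?thesis unfolding m by simp
qed

subsection \<open>Vectors in Minkowski multiples\<close>

lemma sum_lessThan_add: "(\<Sum>j<k + l. f j) = (\<Sum>j<k. f j) + (\<Sum>j<l. f (k + j) :: 'a::comm_monoid_add)"
  for k l :: nat
  by (induction l) (simp_all add: add.assoc)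

lemma minkowski_multiple_add:
  assumes "x \<in> minkowski_multiple n k A" "y \<in> minkowski_multiple n l A"
  shows "(\<lambda>i\<in>{..<n}. x i + y i) \<in> minkowski_multiple n (k + l) A"
proof -
  obtain a b where a: "\<forall>j<k. a j \<in> A" "x = (\<lambda>i\<in>{..<n}. \<Sum>j<k. a j i)"
    and b: "\<forall>j<l. b j \<in> A" "y = (\<lambda>i\<in>{..<n}. \<Sum>j<l. b j i)"
    using assms unfolding minkowski_multiple_def by auto
  define c where "c j = (if j < k then a j else b (j - k))" for j
  have "\<forall>j<k + l. c j \<in> A" using a(1) b(1) by (auto simp: c_def)
  moreover have "(\<lambda>i\<in>{..<n}. x i + y i) = (\<lambda>i\<in>{..<n}. \<Sum>j<k + l. c j i)"
    by (auto simp: a(2) b(2) c_def sum_lessThan_add fun_eq_iff)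
  ultimately show ?thesis unfolding minkowski_multiple_def by blast
qed

lemma minkowski_multiple_sum:
  assumes "\<And>c. c < m \<Longrightarrow> v c \<in> minkowski_multiple n k A"
  shows "(\<lambda>i\<in>{..<n}. \<Sum>c<m. v c i) \<in> minkowski_multiple n (m * k) A"
  using assms
proof (induction m)
  case 0
  then show ?case by (simp add: minkowski_multiple_def restrict_def)
next
  case (Suc m)
  have "(\<lambda>i\<in>{..<n}. (\<lambda>i\<in>{..<n}. \<Sum>c<m. v c i) i + v m i) \<in> minkowski_multiple n (m * k + k) A"
    by (intro minkowski_multiple_add Suc.IH Suc.prems) auto
  then show ?case by (simp add: add.commute restrict_def cong: if_cong)
qed

lemma minkowski_multiple_permute:
  assumes "permutation_invariant n A" "A \<subseteq> topspace (Rn n)" "\<sigma> permutes {..<n}"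
    and "x \<in> minkowski_multiple n k A"
  shows "x \<circ> \<sigma> \<in> minkowski_multiple n k A"
proof -
  obtain a where a: "\<forall>j<k. a j \<in> A" "x = (\<lambda>i\<in>{..<n}. \<Sum>j<k. a j i)"
    using assms(4) unfolding minkowski_multiple_def by auto
  have "\<forall>j<k. a j \<circ> \<sigma> \<in> A"
    using a(1) assms(1-3) unfolding permutation_invariant_def by blast
  moreover have "x \<circ> \<sigma> = (\<lambda>i\<in>{..<n}. \<Sum>j<k. (a j \<circ> \<sigma>) i)"
    using permutes_in_image[OF assms(3)] by (auto simp: a(2) fun_eq_iff)
  ultimately show ?thesis unfolding minkowski_multiple_def
    by (intro CollectI exI[of _ "\<lambda>j. a j \<circ> \<sigma>"] conjI)
qed

lemma minkowski_multiple_twoI: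
  assumes "a \<in> A" "b \<in> A" "\<And>i. i < n \<Longrightarrow> x i = a i + b i" "x \<in> extensional {..<n}"
  shows "x \<in> minkowski_multiple n 2 A"
proof -
  have "x = (\<lambda>i\<in>{..<n}. \<Sum>j<2. (if j = (0::nat) then a else b) i)"
    using assms(3,4) by (auto simp: fun_eq_iff extensional_def numeral_2_eq_2)
  then show ?thesis using assms(1,2) unfolding minkowski_multiple_def
    by (intro CollectI exI[of _ "\<lambda>j. if j = 0 then a else b"]) auto
qed

text \<open>Two events with probabilities at least 2/3 and 2/3 - 1/4 must meet, and a common point
  \<open>x\<close> gives \<open>z = x + (z - x)\<close> with both summands in
  \<open>A\<close>.\<close>

lemma small_in_minkowski_two:
  assumes A: "2 / 3 \<le> measure (std_gaussian n) A" and z: "(\<Sum>i<n. (z i)\<^sup>2) \<le> 1 / 25"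
  shows "(\<lambda>i\<in>{..<n}. z i) \<in> minkowski_multiple n 2 A"
proof -
  interpret prob_space "std_gaussian n" by (rule prob_space_std_gaussian)
  \<comment> \<open>\<open>measure\<close> takes the value 0 outside the sigma-algebra, so a
    positive lower bound forces measurability.\<close>
  have [measurable]: "A \<in> sets (std_gaussian n)"
    using A measure_notin_sets[of A "std_gaussian n"] by fastforce
  define B where "B = {x \<in> space (std_gaussian n). (\<lambda>i\<in>{..<n}. z i - x i) \<in> A}"
  have B: "2 / 3 - 1 / 4 \<le> prob B"
    using prob_reflect_ge[of "{..<n}" A z] A z unfolding B_def std_gaussian_def
    by (simp add: \<open>A \<in> sets (std_gaussian n)\<close>[unfolded std_gaussian_def])
  then have [measurable]: "B \<in> sets (std_gaussian n)"
    using measure_notin_sets[of B "std_gaussian n"] by fastforce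
  have "A \<inter> B \<noteq> {}"
    using finite_measure_Union[of A B] prob_le_1[of "A \<union> B"] A B by auto
  then obtain x where x: "x \<in> A" "(\<lambda>i\<in>{..<n}. z i - x i) \<in> A" by (auto simp: B_def)
  then show ?thesis by (auto intro: minkowski_multiple_twoI)
qed

text \<open>If \<open>v\<close> is not in \<open>A + A\<close>, neither is any rearrangement of it,
  so \<open>- x\<close> and \<open>x + v'\<close> never both lie in \<open>A\<close>. The swap bound
  then limits twice the measure of \<open>A\<close>, which is at least 4/3.\<close>

lemma matching_in_minkowski_two:
  assumes inv: "permutation_invariant n A" and sub: "A \<subseteq> topspace (Rn n)"
    and A: "2 / 3 \<le> measure (std_gaussian n) A"
    and v: "matching {..<n} M v" and cost: "6 * swap_cost M \<le> real n"
  shows "(\<lambda>i\<in>{..<n}. v i) \<in> minkowski_multiple n 2 A"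
proof (rule ccontr)
  let ?P = "PiM {..<n} (\<lambda>_. std_normal)"
  interpret prob_space ?P by (intro prob_space_PiM prob_space_normal_density) simp
  assume contra: "(\<lambda>i\<in>{..<n}. v i) \<notin> minkowski_multiple n 2 A"
  have A': "2 / 3 \<le> prob A" using A by (simp add: std_gaussian_def)
  then have A_sets[measurable]: "A \<in> sets ?P"
    using measure_notin_sets[of A ?P] by fastforce
  \<comment> \<open>The swap bound is about differences of points; the reflection in \<open>F\<close> turns them into sums.\<close>
  define F G :: "(nat \<Rightarrow> real) \<Rightarrow> ennreal"
    where "F x = indicator A (\<lambda>i\<in>{..<n}. 0 - x i)" and "G = indicator A" for x
  have meas: "F \<in> borel_measurable ?P" "G \<in> borel_measurable ?P"
    unfolding F_def[abs_def] G_def by measurable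
  have "integral\<^sup>N ?P F = emeasure (distr ?P ?P (\<lambda>x. \<lambda>i\<in>{..<n}. 0 - x i)) A"
    unfolding F_def by (subst emeasure_distr) (auto simp flip: nn_integral_indicator
      intro!: nn_integral_cong split: split_indicator)
  also have "\<dots> = emeasure ?P A"
    by (subst distr_PiM_std_normal_reflect) (auto simp: shift_density_def density_1)
  finally have F: "integral\<^sup>N ?P F = ennreal (prob A)" by (simp add: emeasure_eq_measure)
  have G: "integral\<^sup>N ?P G = ennreal (prob A)" by (simp add: G_def emeasure_eq_measure)
  have "integral\<^sup>N ?P F + integral\<^sup>N ?P G \<le> ennreal (1 + swap_cost M / (real (n div 2) + 1))"
  proof (rule matching_swap_bound[OF _ _ meas])
    fix x v' assume x: "x \<in> space ?P" and v': "matching {..<n} M v'"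
    show "F x + G (\<lambda>i\<in>{..<n}. x i + v' i) \<le> 1"
    proof (rule ccontr)
      assume "\<not> ?thesis"
      then have "(\<lambda>i\<in>{..<n}. 0 - x i) \<in> A" "(\<lambda>i\<in>{..<n}. x i + v' i) \<in> A"
        by (auto simp: F_def G_def split: split_indicator_asm)
      then have "(\<lambda>i\<in>{..<n}. v' i) \<in> minkowski_multiple n 2 A"
        by (rule minkowski_multiple_twoI) auto
      moreover obtain p where p: "p permutes {..<n}" "\<forall>i\<in>{..<n}. v i = v' (p i)"
        using image_mset_eq_implies_permutes[of "{..<n}" v v'] v v' by (auto simp: matching_def)
      ultimately have "(\<lambda>i\<in>{..<n}. v' i) \<circ> p \<in> minkowski_multiple n 2 A"
        using minkowski_multiple_permute[OF inv sub] by blast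
      moreover have "(\<lambda>i\<in>{..<n}. v' i) \<circ> p = (\<lambda>i\<in>{..<n}. v i)"
        using p permutes_in_image[OF p(1)] by (auto simp: fun_eq_iff)
      ultimately show False using contra by simp
    qed
  qed (auto simp: F_def G_def split: split_indicator)
  then have "2 * prob A \<le> 1 + swap_cost M / (real (n div 2) + 1)"
    unfolding F G using swap_cost_nonneg[of M]
    by (simp flip: ennreal_plus)
  with A' have "1 / 3 \<le> swap_cost M / (real (n div 2) + 1)" by linarith
  \<comment> \<open>Here the factor 6 originates: a third of the number of pairs, which is about
    \<open>n / 2\<close>.\<close>
  then have "real (n div 2) + 1 \<le> 3 * swap_cost M" by (simp add: field_simps)
  moreover have "real n < real (2 * (n div 2 + 1))" by (subst of_nat_less_iff) presburger
  ultimately show False using cost by linarith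
qed

text \<open>The value \<open>f k\<close> enters coordinate \<open>k - 1\<close> with sign plus and
  coordinate \<open>k\<close> with sign minus. For \<open>k\<close> in one residue class modulo
  \<open>R \<ge> 2\<close> these pairs are disjoint, so each class is a matching and takes two
  summands. The 12 is the factor 6 for matchings times the 2 in \<open>swap_cost\<close>.\<close>

lemma path_flow_in_minkowski:
  assumes inv: "permutation_invariant n A" and sub: "A \<subseteq> topspace (Rn n)"
    and A: "2 / 3 \<le> measure (std_gaussian n) A"
    and f: "f 0 = 0" "f n = 0" and R: "2 \<le> R"
    and cost: "\<And>c. c < R \<Longrightarrow> 12 * (\<Sum>k | k \<in> {1..<n} \<and> k mod R = c. exp ((f k)\<^sup>2 / 2)) \<le> real n"
  shows "(\<lambda>i\<in>{..<n}. f (Suc i) - f i) \<in> minkowski_multiple n (R * 2) A"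
proof -
  define v where "v c i = (if Suc i mod R = c then f (Suc i) else 0) - (if i mod R = c then f i else 0)" for c i
  have "(\<lambda>i\<in>{..<n}. v c i) \<in> minkowski_multiple n 2 A" if c: "c < R" for c
  proof (rule matching_in_minkowski_two[OF inv sub A])
    define S where "S = {k. k \<in> {1..<n} \<and> k mod R = c}"
    \<comment> \<open>\<open>P\<close> and \<open>S\<close> hold the left and right coordinates of
      the pairs of class \<open>c\<close>.\<close>
    define P where "P = {i. Suc i \<in> S}"
    have S: "finite S" "S = Suc ` P"
    proof -
      show "finite S" by (simp add: S_def)
      show "S = Suc ` P" unfolding P_def S_def
        by (auto simp: image_iff) (metis Suc_le_D One_nat_def)
    qed
    then have P: "finite P" using finite_imageD[of Suc P] by simp
    have PS: "P \<inter> S = {}" "P \<union> S \<subseteq> {..<n}"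
      using R c by (auto simp: P_def S_def mod_Suc split: if_splits)
    have Sn: "Suc i mod R \<noteq> c" if "i \<in> S" for i
      using that R c by (auto simp: S_def mod_Suc)
    have Pn: "i mod R \<noteq> c" if "i \<in> P" for i
      using that R c by (auto simp: S_def P_def mod_Suc split: if_splits)
    let ?M = "image_mset f (mset_set S)"
    have "mset_set {..<n} = mset_set P + mset_set S + mset_set ({..<n} - (P \<union> S))"
    proof -
      have "mset_set ((P \<union> S) \<union> ({..<n} - (P \<union> S))) = mset_set (P \<union> S) + mset_set ({..<n} - (P \<union> S))"
        using P S(1) by (intro mset_set_Union) auto
      moreover have "mset_set (P \<union> S) = mset_set P + mset_set S"
        using P S(1) PS(1) by (intro mset_set_Union)
      moreover have "(P \<union> S) \<union> ({..<n} - (P \<union> S)) = {..<n}" using PS(2) by auto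
      ultimately show ?thesis by simp
    qed
    moreover have "image_mset (v c) (mset_set P) = ?M"
    proof -
      have "?M = image_mset f (image_mset Suc (mset_set P))" by (simp add: S(2) image_mset_mset_set)
      also have "\<dots> = image_mset (v c) (mset_set P)"
      proof -
        have "v c i = f (Suc i)" if "i \<in> P" for i
          using that Pn[OF that] by (simp add: v_def P_def S_def)
        then show ?thesis using P by (auto simp: multiset.map_comp comp_def intro!: image_mset_cong)
      qed
      finally show ?thesis ..
    qed
    moreover have "image_mset (v c) (mset_set S) = image_mset uminus ?M"
    proof -
      have "v c i = - f i" if "i \<in> S" for i
        using that Sn[OF that] by (simp add: v_def S_def)
      then show ?thesis using S(1) by (auto simp: multiset.map_comp comp_def intro!: image_mset_cong)
    qed
    moreover have "image_mset (v c) (mset_set ({..<n} - (P \<union> S))) = replicate_mset (card {..<n} - 2 * size ?M) 0"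
    proof -
      \<comment> \<open>Outside the pairs only the flow at the two ends of the path could
        contribute, and it vanishes there.\<close>
      have "v c i = 0" if "i < n" "i \<notin> P" "i \<notin> S" for i
      proof -
        have "Suc i mod R = c \<Longrightarrow> Suc i = n" using that by (auto simp: P_def S_def)
        moreover have "i mod R = c \<Longrightarrow> i = 0" using that by (auto simp: S_def)
        ultimately show ?thesis using f by (auto simp: v_def)
      qed
      then have "image_mset (v c) (mset_set ({..<n} - (P \<union> S))) = image_mset (\<lambda>_. 0) (mset_set ({..<n} - (P \<union> S)))"
        by (intro image_mset_cong) auto
      moreover have "card ({..<n} - (P \<union> S)) = n - 2 * card S"
      proof -
        have "card (P \<union> S) = card P + card S" by (rule card_Un_disjoint[OF P S(1) PS(1)])
        also have "card P = card S" using card_image[of Suc P] S(2) by simp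
        finally show ?thesis using P S(1) PS(2) by (subst card_Diff_subset) auto
      qed
      ultimately show ?thesis by (simp add: image_mset_const_eq)
    qed
    ultimately show "matching {..<n} ?M (v c)"
      unfolding matching_def by simp
    show "6 * swap_cost ?M \<le> real n"
    proof -
      have "swap_cost ?M = (\<Sum>k\<in>S. 2 * exp ((f k)\<^sup>2 / 2))"
        unfolding swap_cost_def by (simp add: sum_unfold_sum_mset multiset.map_comp comp_def)
      then show ?thesis using cost[OF c] by (simp add: S_def sum_distrib_left)
    qed
  qed
  then have "(\<lambda>i\<in>{..<n}. \<Sum>c<R. (\<lambda>i\<in>{..<n}. v c i) i) \<in> minkowski_multiple n (R * 2) A"
    by (rule minkowski_multiple_sum)
  moreover have "(\<Sum>c<R. v c i) = f (Suc i) - f i" for i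
  proof -
    have "(\<Sum>c<R. if k mod R = c then f k else 0) = f k" for k
      using R by simp
    then show ?thesis unfolding v_def sum_subtractf by simp
  qed
  ultimately show ?thesis by (simp add: restrict_def cong: if_cong)
qed

subsection \<open>Orderings of finite sequences\<close>

text \<open>Greedy choice: the remaining elements sum to \<open>- s\<close>, so for
  \<open>s \<noteq> 0\<close> one of them does not have the sign of \<open>s\<close>, and adding it
  stays within \<open>[-1, 1]\<close>. The starting value \<open>s\<close> is general for the sake
  of the induction.\<close>

lemma bounded_prefix_sums_ordering:
  fixes X :: "real multiset"
  assumes "\<And>x. x \<in># X \<Longrightarrow> \<bar>x\<bar> \<le> 1" "\<bar>s\<bar> \<le> 1" "s + sum_mset X = 0"
  obtains xs where "mset xs = X" "\<And>k. k \<le> length xs \<Longrightarrow> \<bar>s + sum_list (take k xs)\<bar> \<le> 1"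
proof -
  have "\<exists>xs. mset xs = X \<and> (\<forall>k\<le>length xs. \<bar>s + sum_list (take k xs)\<bar> \<le> 1)"
    using assms
  proof (induction "size X" arbitrary: X s)
    case 0
    then show ?case by simp
  next
    case (Suc m)
    have "\<exists>x. x \<in># X \<and> \<bar>s + x\<bar> \<le> 1"
    proof (rule ccontr)
      assume far: "\<not> ?thesis"
      have nonempty: "X \<noteq> {#}" using Suc.hyps by auto
      show False
      proof (cases "s = 0")
        case True
        then show False using nonempty far Suc.prems(1) by (metis add_0 multiset_nonemptyE)
      next
        case False
        have "0 < s * x" if "x \<in># X" for x
        proof (rule ccontr)
          assume "\<not> ?thesis"
          then have "\<bar>s + x\<bar> \<le> max \<bar>s\<bar> \<bar>x\<bar>"
            by (cases "s \<ge> 0"; cases "x \<ge> 0") (auto simp: zero_less_mult_iff)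
          then show False using far that Suc.prems(1)[OF that] Suc.prems(2) by fastforce
        qed
        then have "0 \<le> (\<Sum>x\<in>#X. s * x)"
          using sum_mset_mono[of X "\<lambda>_. 0" "\<lambda>x. s * x"] by (simp add: less_imp_le)
        moreover have "(\<Sum>x\<in>#X. s * x) = s * sum_mset X"
          by (induction X) (simp_all add: distrib_left)
        ultimately have "0 \<le> s * sum_mset X" by simp
        then have "0 \<le> s * (- s)" using Suc.prems(3) by (metis add.commute eq_neg_iff_add_eq_0)
        then show False using False zero_less_power2[of s] by (simp add: power2_eq_square)
      qed
    qed
    then obtain x where x: "x \<in># X" "\<bar>s + x\<bar> \<le> 1" by blast
    then obtain Y where X: "X = add_mset x Y" by (meson mset_add)
    have "\<exists>ys. mset ys = Y \<and> (\<forall>k\<le>length ys. \<bar>(s + x) + sum_list (take k ys)\<bar> \<le> 1)"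
      using Suc X x by (intro Suc.hyps(1)) (auto simp: add.assoc)
    then obtain ys where ys: "mset ys = Y" "\<forall>k\<le>length ys. \<bar>(s + x) + sum_list (take k ys)\<bar> \<le> 1" by blast
    have "\<bar>s + sum_list (take k (x # ys))\<bar> \<le> 1" if "k \<le> length (x # ys)" for k
      using that ys(2) Suc.prems(2) by (cases k) (auto simp: add.assoc)
    then show ?case using ys(1) X by (intro exI[of _ "x # ys"]) simp
  qed
  then show ?thesis using that by blast
qed

section \<open>The soft-threshold queue\<close>

definition soft_threshold :: "real \<Rightarrow> real" where
  "soft_threshold y = y - max (- 1) (min 1 y)"

text \<open>The backlog transported along the path, a signed analogue of the Lindley recursion: each
  step receives an entry and serves at most one unit.\<close>

definition queue :: "real \<Rightarrow> real list \<Rightarrow> real" where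
  "queue = foldl (\<lambda>g x. soft_threshold (g + x))"

text \<open>Subtracting 1, the cost of an empty queue, lets only the busy steps count. The baseline
  is accounted for separately by the size of a residue class.\<close>

definition excess_cost :: "real \<Rightarrow> real" where
  "excess_cost g = exp (g\<^sup>2 / 2) - 1"

lemma queue_simps [simp]: "queue g [] = g" "queue g (x # xs) = queue (soft_threshold (g + x)) xs"
  by (simp_all add: queue_def)

lemma queue_append: "queue g (xs @ ys) = queue (queue g xs) ys"
  by (simp add: queue_def)

text \<open>The initial backlog is left out, so that the costs of consecutive runs add up.\<close>

fun queue_cost :: "real \<Rightarrow> real list \<Rightarrow> real" where
  "queue_cost g [] = 0"
| "queue_cost g (x # xs) = excess_cost (soft_threshold (g + x)) + queue_cost (soft_threshold (g + x)) xs"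

lemma queue_cost_append: "queue_cost g (xs @ ys) = queue_cost g xs + queue_cost (queue g xs) ys"
  by (induction xs arbitrary: g) auto

lemma queue_cost_eq_sum: "queue_cost g xs = (\<Sum>k<length xs. excess_cost (queue g (take (Suc k) xs)))"
  by (induction xs arbitrary: g) (simp_all add: sum.lessThan_Suc_shift del: sum.lessThan_Suc)

lemma excess_cost_mono: "\<bar>g\<bar> \<le> \<bar>h\<bar> \<Longrightarrow> excess_cost g \<le> excess_cost h"
  by (simp add: excess_cost_def abs_le_square_iff)

lemma excess_cost_nonneg: "0 \<le> excess_cost g"
  by (simp add: excess_cost_def)

lemma abs_soft_threshold_small: "\<bar>x\<bar> \<le> 1 / 2 \<Longrightarrow> \<bar>soft_threshold (g + x)\<bar> \<le> max 0 (\<bar>g\<bar> - 1 / 2)"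
  by (auto simp: soft_threshold_def)

text \<open>An entry of size at most 1/2 meets service 1, so the backlog shrinks by 1/2 per step
  until it is zero. The fixed bound \<open>h\<close> survives the induction while \<open>g\<close>
  changes.\<close>

lemma queue_drains:
  assumes "\<And>x. x \<in> set xs \<Longrightarrow> \<bar>x\<bar> \<le> 1 / 2"
  shows "2 * \<bar>g\<bar> \<le> real (length xs) \<Longrightarrow> queue g xs = 0"
    and "\<bar>g\<bar> \<le> \<bar>h\<bar> \<Longrightarrow> queue_cost g xs \<le> real (length xs) * excess_cost h"
  using assms
proof (induction xs arbitrary: g)
  case (Cons x xs)
  {
    case 1
    have "\<bar>soft_threshold (g + x)\<bar> \<le> max 0 (\<bar>g\<bar> - 1 / 2)"
      using 1 by (intro abs_soft_threshold_small) simp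
    then show ?case using 1 Cons.IH(1)[of "soft_threshold (g + x)"] by (auto simp: max_def split: if_splits)
  next
    case 2
    have "\<bar>soft_threshold (g + x)\<bar> \<le> max 0 (\<bar>g\<bar> - 1 / 2)"
      using 2 by (intro abs_soft_threshold_small) simp
    then have g: "\<bar>soft_threshold (g + x)\<bar> \<le> \<bar>h\<bar>" using 2 by linarith
    then show ?case using Cons.IH(2)[of "soft_threshold (g + x)"] 2 excess_cost_mono[OF g]
      by (simp add: algebra_simps)
  }
qed auto

text \<open>Each big entry is followed by just enough small ones to empty the queue. Every block
  thus starts from 0, and within it the backlog never exceeds the big entry; the surplus small
  entries come last and leave the queue empty.\<close>

lemma queue_ordering:
  assumes "\<And>x. x \<in> set small \<Longrightarrow> \<bar>x\<bar> \<le> 1 / 2"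
    and "(\<Sum>b\<leftarrow>big. nat \<lceil>2 * \<bar>b\<bar>\<rceil>) \<le> length small"
  obtains xs where "mset xs = mset big + mset small" "queue 0 xs = 0"
    "queue_cost 0 xs \<le> (\<Sum>b\<leftarrow>big. (real (nat \<lceil>2 * \<bar>b\<bar>\<rceil>) + 1) * excess_cost b)"
proof -
  have "\<exists>xs. mset xs = mset big + mset small \<and> queue 0 xs = 0 \<and>
    queue_cost 0 xs \<le> (\<Sum>b\<leftarrow>big. (real (nat \<lceil>2 * \<bar>b\<bar>\<rceil>) + 1) * excess_cost b)"
    using assms
  proof (induction big arbitrary: small)
    case Nil
    then show ?case using queue_drains[of small 0] queue_drains(2)[of small 0 0]
      by (intro exI[of _ small]) (auto simp: excess_cost_def)
  next
    case (Cons b big)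
    define r where "r = nat \<lceil>2 * \<bar>b\<bar>\<rceil>"
    have len: "length (take r small) = r" using Cons.prems(2) by (simp add: r_def)
    have "(\<Sum>b\<leftarrow>big. nat \<lceil>2 * \<bar>b\<bar>\<rceil>) \<le> length (drop r small)"
      using Cons.prems(2) by (simp add: r_def)
    moreover have "\<bar>x\<bar> \<le> 1 / 2" if "x \<in> set (drop r small)" for x
      using Cons.prems(1) in_set_dropD[OF that] .
    ultimately obtain xs where xs: "mset xs = mset big + mset (drop r small)" "queue 0 xs = 0"
      "queue_cost 0 xs \<le> (\<Sum>b\<leftarrow>big. (real (nat \<lceil>2 * \<bar>b\<bar>\<rceil>) + 1) * excess_cost b)"
      using Cons.IH by blast
    let ?g = "soft_threshold b"
    have g: "\<bar>?g\<bar> \<le> \<bar>b\<bar>" by (auto simp: soft_threshold_def)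
    have small: "\<bar>x\<bar> \<le> 1 / 2" if "x \<in> set (take r small)" for x
      using that Cons.prems(1) by (auto dest: in_set_takeD)
    have "2 * \<bar>?g\<bar> \<le> real r" using g by (simp add: r_def) linarith
    then have q: "queue ?g (take r small) = 0"
      by (intro queue_drains(1)[OF small]) (simp_all only: len)
    have "queue_cost ?g (take r small) \<le> real r * excess_cost b"
      using queue_drains(2)[of "take r small", OF small g] unfolding len .
    then have "queue_cost 0 (b # take r small @ xs) \<le> (real r + 1) * excess_cost b + queue_cost 0 xs"
      using excess_cost_mono[OF g] by (simp add: queue_cost_append q algebra_simps)
    moreover have "mset (b # take r small @ xs) = mset (b # big) + mset small"
      using xs(1) by (simp add: union_assoc[symmetric] flip: mset_append)
        (metis append_take_drop_id mset_append union_commute union_lcomm)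
    moreover have "queue 0 (b # take r small @ xs) = 0" by (simp add: queue_append q xs(2))
    ultimately show ?case using xs(3)
      by (intro exI[of _ "b # take r small @ xs"]) (auto simp: r_def)
  qed
  then show ?thesis using that by blast
qed

subsection \<open>The convex body\<close>

text \<open>Both constraints are convex and typical: the coordinate sum has standard deviation
  \<open>sqrt n\<close>, and \<open>exp (g\<^sup>2 / 4)\<close> has mean \<open>sqrt 2\<close> for a
  standard Gaussian \<open>g\<close>. The first controls the mean of \<open>x\<close>, the second
  its large entries.\<close>

definition gaussian_body :: "nat \<Rightarrow> (nat \<Rightarrow> real) set" where
  "gaussian_body n = {x \<in> topspace (Rn n).
     \<bar>\<Sum>i<n. x i\<bar> \<le> 4 * sqrt (real n) \<and> (\<Sum>i<n. exp ((x i)\<^sup>2 / 4)) \<le> 4 * real n}"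

lemma permutation_invariant_gaussian_body: "permutation_invariant n (gaussian_body n)"
  unfolding permutation_invariant_def
proof (intro allI impI ballI)
  fix \<sigma> x assume \<sigma>: "\<sigma> permutes {..<n}" and x: "x \<in> topspace (Rn n)"
  have "(\<Sum>i<n. h ((x \<circ> \<sigma>) i)) = (\<Sum>i<n. h (x i))" for h :: "real \<Rightarrow> real"
    using sum.reindex_bij_betw[OF permutes_imp_bij[OF \<sigma>], of "\<lambda>i. h (x i)"] by simp
  note this[of "\<lambda>t. t"] this[of "\<lambda>t. exp (t\<^sup>2 / 4)"]
  moreover have "x \<circ> \<sigma> \<in> topspace (Rn n)"
    using x permutes_not_in[OF \<sigma>] by (auto simp: topspace_Rn PiE_def extensional_def)
  ultimately show "x \<in> gaussian_body n \<longleftrightarrow> x \<circ> \<sigma> \<in> gaussian_body n"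
    using x by (simp add: gaussian_body_def)
qed

lemma convex_in_gaussian_body: "convex_in n (gaussian_body n)"
  unfolding convex_in_def
proof (intro ballI allI impI)
  fix x y :: "nat \<Rightarrow> real" and u v :: real
  assume x: "x \<in> gaussian_body n" and y: "y \<in> gaussian_body n" and uv: "0 \<le> u" "0 \<le> v" "u + v = 1"
  have "\<bar>\<Sum>i<n. u * x i + v * y i\<bar> \<le> u * \<bar>\<Sum>i<n. x i\<bar> + v * \<bar>\<Sum>i<n. y i\<bar>"
    using uv abs_triangle_ineq[of "u * (\<Sum>i<n. x i)" "v * (\<Sum>i<n. y i)"]
    by (simp add: sum.distrib abs_mult flip: sum_distrib_left)
  also have "\<dots> \<le> u * (4 * sqrt (real n)) + v * (4 * sqrt (real n))"
    using x y uv by (intro add_mono mult_left_mono) (auto simp: gaussian_body_def)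
  also have "\<dots> = 4 * sqrt (real n)" using uv by (simp flip: distrib_right)
  finally have 1: "\<bar>\<Sum>i<n. u * x i + v * y i\<bar> \<le> 4 * sqrt (real n)" .
  have "exp ((u * s + v * t)\<^sup>2 / 4) \<le> u * exp (s\<^sup>2 / 4) + v * exp (t\<^sup>2 / 4)" for s t :: real
  proof -
    have u: "u = 1 - v" using uv by simp
    have "0 \<le> u * v * (s - t)\<^sup>2" using uv by simp
    then have "(u * s + v * t)\<^sup>2 \<le> u * s\<^sup>2 + v * t\<^sup>2"
      unfolding u by (simp add: power2_eq_square algebra_simps)
    then have "exp ((u * s + v * t)\<^sup>2 / 4) \<le> exp (u * (s\<^sup>2 / 4) + v * (t\<^sup>2 / 4))"
      by simp
    also have "\<dots> \<le> u * exp (s\<^sup>2 / 4) + v * exp (t\<^sup>2 / 4)"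
      using convex_onD[OF exp_convex, of v "s\<^sup>2 / 4" "t\<^sup>2 / 4"] uv unfolding u by simp
    finally show ?thesis .
  qed
  then have "(\<Sum>i<n. exp ((u * x i + v * y i)\<^sup>2 / 4)) \<le> (\<Sum>i<n. u * exp ((x i)\<^sup>2 / 4) + v * exp ((y i)\<^sup>2 / 4))"
    by (rule sum_mono)
  also have "\<dots> = u * (\<Sum>i<n. exp ((x i)\<^sup>2 / 4)) + v * (\<Sum>i<n. exp ((y i)\<^sup>2 / 4))"
    by (simp add: sum.distrib sum_distrib_left)
  also have "\<dots> \<le> u * (4 * real n) + v * (4 * real n)"
    using x y uv by (intro add_mono mult_left_mono) (auto simp: gaussian_body_def)
  also have "\<dots> = 4 * real n" using uv by (simp flip: distrib_right)
  finally have 2: "(\<Sum>i<n. exp ((u * x i + v * y i)\<^sup>2 / 4)) \<le> 4 * real n" .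
  show "(\<lambda>i\<in>{..<n}. u * x i + v * y i) \<in> gaussian_body n"
    using 1 2 by (simp add: gaussian_body_def topspace_Rn)
qed

lemma gaussian_body_sum_squares:
  assumes "x \<in> gaussian_body n"
  shows "(\<Sum>i<n. (x i)\<^sup>2) \<le> 12 * real n"
proof -
  have "(\<Sum>i<n. 1 + (x i)\<^sup>2 / 4) \<le> (\<Sum>i<n. exp ((x i)\<^sup>2 / 4))"
    by (intro sum_mono exp_ge_add_one_self)
  then show ?thesis using assms by (simp add: gaussian_body_def sum.distrib flip: sum_divide_distrib)
qed

lemma convex_body_gaussian_body:
  assumes n: "1 \<le> n"
  shows "convex_body n (gaussian_body n)"
proof -
  have proj: "continuous_map (Rn n) euclideanreal (\<lambda>x. x i)" if "i < n" for i
    using that continuous_map_product_projection[of i "{..<n}" "\<lambda>_. euclideanreal"] by (simp add: Rn_def)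
  have S: "continuous_map (Rn n) euclideanreal (\<lambda>x. \<Sum>i<n. x i)"
    using proj by (intro continuous_map_sum) auto
  have E: "continuous_map (Rn n) euclideanreal (\<lambda>x. \<Sum>i<n. exp ((x i)\<^sup>2 / 4))"
  proof (rule continuous_map_sum)
    fix i assume "i \<in> {..<n}"
    then have "continuous_map (Rn n) euclideanreal ((\<lambda>t. exp (t\<^sup>2 / 4)) \<circ> (\<lambda>x. x i))"
      using proj by (intro continuous_map_compose[of _ euclideanreal]) (auto intro!: continuous_intros)
    then show "continuous_map (Rn n) euclideanreal (\<lambda>x. exp ((x i)\<^sup>2 / 4))" by (simp add: comp_def)
  qed simp
  have closed: "closedin (Rn n) (gaussian_body n)"
  proof -
    have "closedin (Rn n) ({x \<in> topspace (Rn n). (\<Sum>i<n. x i) \<in> {- (4 * sqrt (real n))..4 * sqrt (real n)}} \<inter>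
        {x \<in> topspace (Rn n). (\<Sum>i<n. exp ((x i)\<^sup>2 / 4)) \<in> {..4 * real n}})"
      by (intro closedin_Int closedin_continuous_map_preimage[OF S] closedin_continuous_map_preimage[OF E]) auto
    also have "\<dots> = gaussian_body n" by (auto simp: gaussian_body_def abs_le_iff)
    finally show ?thesis .
  qed
  have "compactin (Rn n) (gaussian_body n)"
  proof (rule closed_compactin[OF _ _ closed])
    show "compactin (Rn n) (PiE {..<n} (\<lambda>_. {- (4 * real n)..4 * real n}))"
      by (simp add: Rn_def compactin_PiE)
    show "gaussian_body n \<subseteq> PiE {..<n} (\<lambda>_. {- (4 * real n)..4 * real n})"
    proof
      fix x assume x: "x \<in> gaussian_body n"
      have "\<bar>x i\<bar> \<le> 4 * real n" if "i < n" for i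
      proof (rule power2_le_imp_le)
        have "(x i)\<^sup>2 \<le> (\<Sum>i<n. (x i)\<^sup>2)" using that by (intro member_le_sum) auto
        also have "\<dots> \<le> 12 * real n" using gaussian_body_sum_squares[OF x] .
        also have "\<dots> \<le> (4 * real n)\<^sup>2" using n by (simp add: power2_eq_square)
        finally show "\<bar>x i\<bar>\<^sup>2 \<le> (4 * real n)\<^sup>2" by simp
      qed simp
      then have "\<forall>i\<in>{..<n}. x i \<in> {- (4 * real n)..4 * real n}" by (auto simp: abs_le_iff minus_le_iff)
      then show "x \<in> PiE {..<n} (\<lambda>_. {- (4 * real n)..4 * real n})"
        using x by (auto simp: gaussian_body_def topspace_Rn PiE_def)
    qed
  qed
  moreover have "Rn n interior_of gaussian_body n \<noteq> {}"
  proof -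
    let ?U = "{x \<in> topspace (Rn n). (\<Sum>i<n. x i) \<in> {- (4 * sqrt (real n))<..<4 * sqrt (real n)}} \<inter>
        {x \<in> topspace (Rn n). (\<Sum>i<n. exp ((x i)\<^sup>2 / 4)) \<in> {..<4 * real n}}"
    have "openin (Rn n) ?U"
      by (intro openin_Int openin_continuous_map_preimage[OF S] openin_continuous_map_preimage[OF E]) auto
    moreover have "?U \<subseteq> gaussian_body n" by (auto simp: gaussian_body_def)
    ultimately have "?U \<subseteq> Rn n interior_of gaussian_body n" by (intro interior_of_maximal)
    moreover have "(\<lambda>i\<in>{..<n}. 0) \<in> ?U" using n by (simp add: topspace_Rn)
    ultimately show ?thesis by blast
  qed
  ultimately show ?thesis
    by (simp add: convex_body_def convex_in_gaussian_body)
qed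

section \<open>Gaussian measure of the body\<close>

lemma nn_integral_std_normal_exp_square:
  "(\<integral>\<^sup>+x. ennreal (exp (x\<^sup>2 / 4)) \<partial>std_normal) = ennreal (sqrt 2)"
proof -
  have "std_normal_density x * exp (x\<^sup>2 / 4) = sqrt 2 * normal_density 0 (sqrt 2) x" for x
  proof -
    have "- x\<^sup>2 / 2 + x\<^sup>2 / 4 = - (x - 0)\<^sup>2 / (2 * (sqrt 2)\<^sup>2)" by simp
    then have "exp (- x\<^sup>2 / 2) * exp (x\<^sup>2 / 4) = exp (- (x - 0)\<^sup>2 / (2 * (sqrt 2)\<^sup>2))"
      by (simp only: exp_add[symmetric])
    then show ?thesis unfolding normal_density_def by (simp add: real_sqrt_mult field_simps)
  qed
  then have "(\<integral>\<^sup>+x. ennreal (exp (x\<^sup>2 / 4)) \<partial>std_normal) = (\<integral>\<^sup>+x. ennreal (sqrt 2) * ennreal (normal_density 0 (sqrt 2) x) \<partial>lborel)"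
    by (subst nn_integral_density) (auto simp: ennreal_mult'[symmetric])
  also have "\<dots> = ennreal (sqrt 2)"
    by (subst nn_integral_cmult) (auto simp: nn_integral_eq_integral)
  finally show ?thesis .
qed

text \<open>Markov's inequality for the exponential sum loses \<open>sqrt 2 / 4\<close>, and a
  Chernoff bound for the coordinate sum loses 2/17; together this is less than 1/2.\<close>

lemma measure_gaussian_body:
  assumes n: "1 \<le> n"
  shows "1 / 2 \<le> measure (std_gaussian n) (gaussian_body n)"
proof -
  let ?P = "PiM {..<n} (\<lambda>_. std_normal)"
  interpret prob_space ?P by (intro prob_space_PiM prob_space_normal_density) simp
  \<comment> \<open>With this slope the translated density is \<open>exp (l * S - 1 / 2)\<close> for
    the coordinate sum \<open>S\<close>. It has mean 1 and exceeds \<open>exp (7 / 2)\<close>, hence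
    17, once \<open>S > 4 * sqrt n\<close>.\<close>
  define l where "l = 1 / sqrt (real n)"
  define E where "E x = (\<Sum>i<n. exp ((x i)\<^sup>2 / 4))" for x :: "nat \<Rightarrow> real"
  let ?L = "\<lambda>s. shift_density {..<n} (\<lambda>_. s)"
  have space: "space ?P = topspace (Rn n)"
    using space_std_gaussian[of n] by (simp add: std_gaussian_def)
  have K_eq: "gaussian_body n = {x \<in> space ?P. \<bar>\<Sum>i<n. x i\<bar> \<le> 4 * sqrt (real n) \<and> (\<Sum>i<n. exp ((x i)\<^sup>2 / 4)) \<le> 4 * real n}"
    by (simp add: gaussian_body_def space)
  have K[measurable]: "gaussian_body n \<in> sets ?P" unfolding K_eq by measurable
  have [measurable]: "E \<in> borel_measurable ?P" unfolding E_def[abs_def] by measurable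
  have E0: "0 \<le> E x" for x unfolding E_def by (intro sum_nonneg) simp
  have L0: "0 \<le> ?L s x" for s x unfolding shift_density_def by (intro prod_nonneg) simp
  have L: "?L s x = exp (s * (\<Sum>i<n. x i) - real n * s\<^sup>2 / 2)" for s x
    unfolding shift_density_def by (simp add: sum_subtractf flip: exp_sum sum_distrib_left)
  have big: "17 \<le> exp (7 / 2 :: real)"
  proof -
    have "(3 / 2) ^ 7 \<le> exp (1 / 2 :: real) ^ 7"
      using exp_ge_add_one_self[of "1 / 2"] by (intro power_mono) auto
    also have "\<dots> = exp (7 / 2)" by (simp flip: exp_of_nat_mult)
    finally show ?thesis by (simp add: power_numeral_reduce)
  qed
  have ptwise: "indicator (space ?P - gaussian_body n) x \<le> E x / (4 * real n) + (?L l x + ?L (- l) x) / 17"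
    if x: "x \<in> space ?P" for x
  proof -
    have l2: "real n * l\<^sup>2 / 2 = 1 / 2" using n by (simp add: l_def power_divide)
    have l4: "l * (4 * sqrt (real n)) = 4" using n by (simp add: l_def)
    have tail: "1 \<le> ?L s x / 17" if "4 * sqrt (real n) < t" "s * (\<Sum>i<n. x i) = l * t" "s\<^sup>2 = l\<^sup>2" for s t
    proof -
      have "l * (4 * sqrt (real n)) \<le> l * t" using that(1) by (intro mult_left_mono) (auto simp: l_def)
      then have "7 / 2 \<le> l * t - real n * s\<^sup>2 / 2"
        unfolding that(3) l2 using l4 by linarith
      then have "exp (7 / 2) \<le> ?L s x" unfolding L that(2) by simp
      with big show ?thesis by simp
    qed
    consider "x \<in> gaussian_body n" | "4 * real n < E x" | "4 * sqrt (real n) < (\<Sum>i<n. x i)"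
      | "4 * sqrt (real n) < - (\<Sum>i<n. x i)"
      using x unfolding K_eq E_def mem_Collect_eq abs_le_iff by (meson not_le)
    then have "indicator (space ?P - gaussian_body n) x \<le> max 0 (E x / (4 * real n)) + (max 0 (?L l x / 17) + max 0 (?L (- l) x / 17))"
    proof cases
      case 1 then show ?thesis by simp
    next
      case 2
      then have "1 \<le> E x / (4 * real n)" using n by (simp add: field_simps)
      then show ?thesis by (auto split: split_indicator)
    next
      case 3
      then have "1 \<le> ?L l x / 17" by (rule tail) auto
      then show ?thesis by (auto split: split_indicator)
    next
      case 4
      then have "1 \<le> ?L (- l) x / 17" by (rule tail) auto
      then show ?thesis by (auto split: split_indicator)
    qed
    then show ?thesis using E0[of x] L0[of l x] L0[of "- l" x] by (simp add: add_divide_distrib)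
  qed
  have E_int: "(\<integral>\<^sup>+x. ennreal (E x) \<partial>?P) = ennreal (real n * sqrt 2)"
  proof -
    have "(\<integral>\<^sup>+x. ennreal (exp ((x i)\<^sup>2 / 4)) \<partial>?P) = ennreal (sqrt 2)" if "i < n" for i
    proof -
      have "distr ?P std_normal (\<lambda>x. x i) = std_normal"
        using that by (intro distr_PiM_component prob_space_normal_density) auto
      moreover have "(\<integral>\<^sup>+x. ennreal (exp (x\<^sup>2 / 4)) \<partial>distr ?P std_normal (\<lambda>x. x i))
          = (\<integral>\<^sup>+x. ennreal (exp ((x i)\<^sup>2 / 4)) \<partial>?P)"
        using that by (intro nn_integral_distr) auto
      ultimately show ?thesis using nn_integral_std_normal_exp_square by simp
    qed
    moreover have "(\<integral>\<^sup>+x. ennreal (E x) \<partial>?P) = (\<Sum>i<n. \<integral>\<^sup>+x. ennreal (exp ((x i)\<^sup>2 / 4)) \<partial>?P)"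
      unfolding E_def by (subst nn_integral_sum[symmetric]) (auto simp: sum_ennreal)
    ultimately have "(\<integral>\<^sup>+x. ennreal (E x) \<partial>?P) = (\<Sum>i<n. ennreal (sqrt 2))" by simp
    then show ?thesis by (simp add: ennreal_mult' ennreal_of_nat_eq_real_of_nat)
  qed
  have "emeasure ?P (space ?P - gaussian_body n) = (\<integral>\<^sup>+x. ennreal (indicator (space ?P - gaussian_body n) x) \<partial>?P)"
    by (simp add: ennreal_indicator)
  also have "\<dots> \<le> (\<integral>\<^sup>+x. ennreal (E x / (4 * real n) + (?L l x + ?L (- l) x) / 17) \<partial>?P)"
    using ptwise by (intro nn_integral_mono ennreal_leI)
  also have "\<dots> = (\<integral>\<^sup>+x. ennreal (1 / (4 * real n)) * ennreal (E x) + (ennreal (1 / 17) * ennreal (?L l x) + ennreal (1 / 17) * ennreal (?L (- l) x)) \<partial>?P)"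
    using E0 L0 by (intro nn_integral_cong) (simp add: add_divide_distrib flip: ennreal_mult' ennreal_plus)
  also have "\<dots> = ennreal (1 / (4 * real n)) * ennreal (real n * sqrt 2) + (ennreal (1 / 17) + ennreal (1 / 17))"
    by (simp add: nn_integral_add nn_integral_cmult E_int nn_integral_shift_density)
  also have "\<dots> = ennreal (sqrt 2 / 4 + 2 / 17)"
    using n by (simp flip: ennreal_mult' ennreal_plus)
  also have "\<dots> \<le> ennreal (1 / 2)"
  proof (rule ennreal_leI)
    have "sqrt 2 \<le> sqrt ((3 / 2)\<^sup>2)" by (subst real_sqrt_le_iff) (simp add: power2_eq_square)
    then show "sqrt 2 / 4 + 2 / 17 \<le> (1 / 2 :: real)" by simp
  qed
  finally have "prob (space ?P - gaussian_body n) \<le> 1 / 2"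
    unfolding emeasure_eq_measure by (subst (asm) ennreal_le_iff) auto
  then show ?thesis by (simp add: prob_compl std_gaussian_def)
qed

subsection \<open>Decomposition of the convex body\<close>

lemma image_mset_nth: "image_mset ((!) xs) (mset_set {..<length xs}) = mset xs"
  using arg_cong[OF map_nth[of xs], of mset] by (simp add: lessThan_atLeast0)

lemma reorder_in_minkowski:
  assumes "permutation_invariant n A" "A \<subseteq> topspace (Rn n)"
    and xs: "mset xs = image_mset y (mset_set {..<n})"
    and "(\<lambda>i\<in>{..<n}. xs ! i) \<in> minkowski_multiple n k A"
  shows "(\<lambda>i\<in>{..<n}. y i) \<in> minkowski_multiple n k A"
proof -
  have len: "length xs = n" using arg_cong[OF xs, of size] by simp
  have "image_mset y (mset_set {..<n}) = image_mset ((!) xs) (mset_set {..<n})"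
    using image_mset_nth[of xs] xs len by simp
  then obtain p where p: "p permutes {..<n}" "\<forall>i\<in>{..<n}. y i = xs ! p i"
    by (rule image_mset_eq_implies_permutes[rotated]) auto
  have "(\<lambda>i\<in>{..<n}. xs ! i) \<circ> p \<in> minkowski_multiple n k A"
    using minkowski_multiple_permute assms p(1) by blast
  moreover have "(\<lambda>i\<in>{..<n}. xs ! i) \<circ> p = (\<lambda>i\<in>{..<n}. y i)"
    using p permutes_in_image[OF p(1)] by (auto simp: fun_eq_iff)
  ultimately show ?thesis by simp
qed

lemma card_residue_class_le:
  assumes R: "0 < R"
  shows "real (card {k \<in> {1..<n}. k mod R = c}) \<le> real n / real R + 1"
proof -
  have "inj_on (\<lambda>k. k div R) {k \<in> {1..<n}. k mod R = c}"
    by (rule inj_onI) (metis (mono_tags, lifting) div_mod_decomp mem_Collect_eq)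
  moreover have "(\<lambda>k. k div R) ` {k \<in> {1..<n}. k mod R = c} \<subseteq> {..n div R}"
    by (auto intro: div_le_mono)
  ultimately have "card {k \<in> {1..<n}. k mod R = c} \<le> card {..n div R}"
    by (intro card_inj_on_le[where f = "\<lambda>k. k div R"]) auto
  then have "real (card {k \<in> {1..<n}. k mod R = c}) \<le> real (n div R) + 1" by simp
  moreover have "real (n div R * R) \<le> real n" by (subst of_nat_le_iff) simp
  then have "real (n div R) \<le> real n / real R" using R by (simp add: field_simps)
  ultimately show ?thesis by linarith
qed

text \<open>The flow consists of prefix sums in the greedy ordering, so each vertex costs at most 2.
  With 48 classes, \<open>12 * 2 * (n / 48 + 1) \<le> n\<close> holds as soon as
  \<open>n \<ge> 48\<close>; two summands per class make 96.\<close>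

lemma bounded_zero_sum_in_minkowski:
  assumes inv: "permutation_invariant n A" "A \<subseteq> topspace (Rn n)" "2 / 3 \<le> measure (std_gaussian n) A"
    and n: "48 \<le> n"
    and e: "\<And>i. i < n \<Longrightarrow> \<bar>e i\<bar> \<le> 1" "(\<Sum>i<n. e i) = 0"
  shows "(\<lambda>i\<in>{..<n}. e i) \<in> minkowski_multiple n 96 A"
proof -
  let ?X = "image_mset e (mset_set {..<n})"
  have "\<bar>x\<bar> \<le> 1" if "x \<in># ?X" for x using that e(1) by auto
  moreover have sum0: "sum_mset ?X = 0" using e(2) by (simp add: sum_unfold_sum_mset)
  ultimately obtain ys where ys: "mset ys = ?X" "\<And>k. k \<le> length ys \<Longrightarrow> \<bar>0 + sum_list (take k ys)\<bar> \<le> 1"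
    using bounded_prefix_sums_ordering[of ?X 0] by auto
  have len: "length ys = n" using arg_cong[OF ys(1), of size] by simp
  let ?f = "\<lambda>k. sum_list (take k ys)"
  have "(\<lambda>i\<in>{..<n}. ?f (Suc i) - ?f i) \<in> minkowski_multiple n (48 * 2) A"
  proof (rule path_flow_in_minkowski[OF inv])
    show "?f n = 0" using sum0 ys(1) len by (metis sum_mset_sum_list take_all order_refl)
    fix c :: nat
    have "(\<Sum>k | k \<in> {1..<n} \<and> k mod 48 = c. exp ((?f k)\<^sup>2 / 2)) \<le> (\<Sum>k | k \<in> {1..<n} \<and> k mod 48 = c. 2)"
    proof (rule sum_mono)
      fix k assume "k \<in> {k. k \<in> {1..<n} \<and> k mod 48 = c}"
      then have "\<bar>?f k\<bar> \<le> 1" using ys(2)[of k] len by simp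
      then have "exp ((?f k)\<^sup>2 / 2) \<le> exp (1 / 2)" by (simp add: abs_square_le_1)
      also have "\<dots> \<le> 1 + 1 / 2 + (1 / 2)\<^sup>2" by (rule exp_bound) auto
      finally show "exp ((?f k)\<^sup>2 / 2) \<le> 2" by (simp add: power2_eq_square)
    qed
    also have "\<dots> \<le> 2 * (real n / 48 + 1)"
      using card_residue_class_le[of 48 n c] by simp
    finally show "12 * (\<Sum>k | k \<in> {1..<n} \<and> k mod 48 = c. exp ((?f k)\<^sup>2 / 2)) \<le> real n"
      using n by simp
  qed simp_all
  moreover have "(\<lambda>i\<in>{..<n}. ?f (Suc i) - ?f i) = (\<lambda>i\<in>{..<n}. ys ! i)"
    using len by (auto simp: take_Suc_conv_app_nth fun_eq_iff)
  ultimately show ?thesis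
    using reorder_in_minkowski[OF inv(1,2) ys(1)] by simp
qed

text \<open>The queue flow takes 96 summands and the bounded residue it leaves takes another
  96.\<close>

lemma zero_sum_in_minkowski:
  assumes inv: "permutation_invariant n A" "A \<subseteq> topspace (Rn n)" "2 / 3 \<le> measure (std_gaussian n) A"
    and n: "48 \<le> n" and y0: "(\<Sum>i<n. y i) = 0"
    and tail: "(\<Sum>i | i < n \<and> 1 / 2 < \<bar>y i\<bar>. (real (nat \<lceil>2 * \<bar>y i\<bar>\<rceil>) + 1) * exp ((y i)\<^sup>2 / 2)) \<le> real n / 100"
  shows "(\<lambda>i\<in>{..<n}. y i) \<in> minkowski_multiple n 192 A"
proof -
  define big where "big = map y (filter (\<lambda>i. 1 / 2 < \<bar>y i\<bar>) [0..<n])"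
  define small where "small = map y (filter (\<lambda>i. \<not> 1 / 2 < \<bar>y i\<bar>) [0..<n])"
  have mset_eq: "mset big + mset small = image_mset y (mset_set {..<n})"
  proof -
    have "mset (filter P xs) + mset (filter (\<lambda>i. \<not> P i) xs) = mset xs" for P and xs :: "nat list"
      by (induction xs) auto
    from arg_cong[OF this, of "image_mset y" "\<lambda>i. 1 / 2 < \<bar>y i\<bar>" "[0..<n]"] show ?thesis
      unfolding big_def small_def by (simp only: mset_map image_mset_union mset_upt lessThan_atLeast0)
  qed
  have big_sum: "(\<Sum>b\<leftarrow>big. h b) = (\<Sum>i | i < n \<and> 1 / 2 < \<bar>y i\<bar>. h (y i))" for h :: "real \<Rightarrow> real"
    unfolding big_def by (simp add: sum_list_distinct_conv_sum_set comp_def)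
  \<comment> \<open>The tail bound also shows that there are enough small entries to drain all big
    ones: each exponential factor is at least 1.\<close>
  have "real (\<Sum>b\<leftarrow>big. nat \<lceil>2 * \<bar>b\<bar>\<rceil>) + real (length big) = (\<Sum>b\<leftarrow>big. real (nat \<lceil>2 * \<bar>b\<bar>\<rceil>) + 1)"
    by (induction big) auto
  also have "\<dots> = (\<Sum>i | i < n \<and> 1 / 2 < \<bar>y i\<bar>. (real (nat \<lceil>2 * \<bar>y i\<bar>\<rceil>) + 1) * 1)"
    by (simp only: big_sum mult_1_right)
  also have "\<dots> \<le> (\<Sum>i | i < n \<and> 1 / 2 < \<bar>y i\<bar>. (real (nat \<lceil>2 * \<bar>y i\<bar>\<rceil>) + 1) * exp ((y i)\<^sup>2 / 2))"
    by (intro sum_mono mult_left_mono) auto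
  also have "\<dots> \<le> real n" using tail by simp
  finally have "(\<Sum>b\<leftarrow>big. nat \<lceil>2 * \<bar>b\<bar>\<rceil>) + length big \<le> n" by linarith
  moreover have "length big + length small = n" using arg_cong[OF mset_eq, of size] by simp
  ultimately have "(\<Sum>b\<leftarrow>big. nat \<lceil>2 * \<bar>b\<bar>\<rceil>) \<le> length small" by linarith
  moreover have "\<bar>x\<bar> \<le> 1 / 2" if "x \<in> set small" for x using that by (auto simp: small_def)
  ultimately obtain xs where xs: "mset xs = mset big + mset small" "queue 0 xs = 0"
    "queue_cost 0 xs \<le> (\<Sum>b\<leftarrow>big. (real (nat \<lceil>2 * \<bar>b\<bar>\<rceil>) + 1) * excess_cost b)"
    using queue_ordering by blast
  have len: "length xs = n" using arg_cong[OF xs(1), of size] mset_eq by simp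
  note xs(3)
  also have "(\<Sum>b\<leftarrow>big. (real (nat \<lceil>2 * \<bar>b\<bar>\<rceil>) + 1) * excess_cost b)
      \<le> (\<Sum>i | i < n \<and> 1 / 2 < \<bar>y i\<bar>. (real (nat \<lceil>2 * \<bar>y i\<bar>\<rceil>) + 1) * exp ((y i)\<^sup>2 / 2))"
    unfolding big_sum by (intro sum_mono mult_left_mono) (auto simp: excess_cost_def)
  also note tail
  finally have qc: "queue_cost 0 xs \<le> real n / 100" .
  define g where "g k = queue 0 (take k xs)" for k
  have g_Suc: "g (Suc i) = soft_threshold (g i + xs ! i)" if "i < n" for i
    using that len by (simp add: g_def take_Suc_conv_app_nth queue_append)
  have g0: "g 0 = 0" "g n = 0" using len xs(2) by (simp_all add: g_def)
  have "(\<lambda>i\<in>{..<n}. g (Suc i) - g i) \<in> minkowski_multiple n (48 * 2) A"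
  proof (rule path_flow_in_minkowski[OF inv g0])
    fix c :: nat
    let ?S = "{k. k \<in> {1..<n} \<and> k mod 48 = c}"
    have "(\<Sum>k\<in>?S. exp ((g k)\<^sup>2 / 2)) = (\<Sum>k\<in>?S. 1 + excess_cost (g k))"
      by (simp add: excess_cost_def)
    also have "\<dots> = real (card ?S) + (\<Sum>k\<in>?S. excess_cost (g k))"
      by (simp add: sum.distrib)
    \<comment> \<open>Even the excess cost of all classes together is affordable.
      \<open>queue_cost\<close> records the backlog after each step, hence the index set shifted by
      one.\<close>
    also have "(\<Sum>k\<in>?S. excess_cost (g k)) \<le> (\<Sum>k\<in>Suc ` {..<n}. excess_cost (g k))"
    proof (rule sum_mono2)
      show "?S \<subseteq> Suc ` {..<n}"
      proof
        fix k assume "k \<in> ?S"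
        then have "k = Suc (k - 1)" "k - 1 \<in> {..<n}" by auto
        then show "k \<in> Suc ` {..<n}" by blast
      qed
    qed (auto simp: excess_cost_nonneg)
    also have "\<dots> = queue_cost 0 xs"
      by (simp add: sum.reindex queue_cost_eq_sum len g_def)
    finally have "(\<Sum>k\<in>?S. exp ((g k)\<^sup>2 / 2)) \<le> real (card ?S) + real n / 100" using qc by simp
    moreover have "real (card ?S) \<le> real n / 48 + 1"
      using card_residue_class_le[of 48 n c] by simp
    ultimately show "12 * (\<Sum>k\<in>?S. exp ((g k)\<^sup>2 / 2)) \<le> real n"
      using n by simp
  qed simp
  \<comment> \<open>What the queue serves at step \<open>i\<close> is a clipped value. The served
    amounts sum to zero because the queue starts and ends empty.\<close>
  moreover have "(\<lambda>i\<in>{..<n}. xs ! i - (g (Suc i) - g i)) \<in> minkowski_multiple n 96 A"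
  proof (rule bounded_zero_sum_in_minkowski[OF inv n])
    show "\<bar>xs ! i - (g (Suc i) - g i)\<bar> \<le> 1" if "i < n" for i
      unfolding g_Suc[OF that] by (auto simp: soft_threshold_def)
    have "(\<Sum>i<n. xs ! i) = (\<Sum>i<n. y i)"
      using arg_cong[OF xs(1), of sum_mset] image_mset_nth[of xs] mset_eq len
      by (simp add: sum_unfold_sum_mset)
    then show "(\<Sum>i<n. xs ! i - (g (Suc i) - g i)) = 0"
      using y0 g0 sum_lessThan_telescope[of g n] sum_subtractf[of "(!) xs" "\<lambda>i. g (Suc i) - g i" "{..<n}"]
      by simp
  qed
  ultimately have "(\<lambda>i\<in>{..<n}. (\<lambda>i\<in>{..<n}. g (Suc i) - g i) i + (\<lambda>i\<in>{..<n}. xs ! i - (g (Suc i) - g i)) i)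
     \<in> minkowski_multiple n (48 * 2 + 96) A"
    by (rule minkowski_multiple_add)
  then have "(\<lambda>i\<in>{..<n}. xs ! i) \<in> minkowski_multiple n 192 A"
    by (simp add: restrict_def cong: if_cong)
  then show ?thesis
    using reorder_in_minkowski[OF inv(1,2)] xs(1) mset_eq by metis
qed

text \<open>Division by 20 makes the exponent so much smaller than \<open>x\<^sup>2 / 4\<close> that
  the surplus absorbs the drainage length and all constants. The 400 turns the bound
  \<open>4 * n\<close> of the body into \<open>n / 100\<close>.\<close>

lemma gaussian_tail_cost:
  fixes x m :: real
  assumes m: "\<bar>m\<bar> \<le> 1" and b: "1 / 2 < \<bar>(x - m) / 20\<bar>"
  shows "(real (nat \<lceil>2 * \<bar>(x - m) / 20\<bar>\<rceil>) + 1) * exp (((x - m) / 20)\<^sup>2 / 2) \<le> exp (x\<^sup>2 / 4) / 400"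
proof -
  define t where "t = \<bar>x\<bar>"
  define b where "b = \<bar>(x - m) / 20\<bar>"
  \<comment> \<open>A scaled entry above 1/2 forces \<open>t \<ge> 9\<close>, and from there on
    \<open>(t + 1) / 20 \<le> t / 18\<close>.\<close>
  have "b \<le> (t + 1) / 20" using m by (simp add: b_def t_def)
  moreover have t9: "9 \<le> t" using calculation b by (simp add: b_def)
  ultimately have bt: "b \<le> t / 18" by simp
  have b0: "0 \<le> b" by (simp add: b_def)
  \<comment> \<open>The rounded-up length plus 1 is at most \<open>2 * (1 + b)\<close>. Then 800 is
    absorbed by \<open>exp 10\<close> and \<open>1 + b\<close> by \<open>exp b\<close>, which leaves
    a comparison of exponents.\<close>
  have "800 * ((real (nat \<lceil>2 * b\<rceil>) + 1) * exp (b\<^sup>2 / 2)) \<le> 800 * ((2 * (1 + b)) * exp (b\<^sup>2 / 2))"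
    using b0 by (intro mult_left_mono mult_right_mono) (auto, linarith)
  also have "\<dots> \<le> 2 * (exp 10 * (exp b * exp (b\<^sup>2 / 2)))"
  proof -
    have "2 ^ 10 \<le> exp (1 :: real) ^ 10"
      using exp_ge_add_one_self[of 1] by (intro power_mono) auto
    then have "800 \<le> exp (10 :: real)" by (simp flip: exp_of_nat_mult)
    moreover have "1 + b \<le> exp b" by (rule exp_ge_add_one_self)
    ultimately have "800 * ((1 + b) * exp (b\<^sup>2 / 2)) \<le> exp 10 * (exp b * exp (b\<^sup>2 / 2))"
      using b0 by (intro mult_mono mult_right_mono) auto
    then show ?thesis by simp
  qed
  also have "exp 10 * (exp b * exp (b\<^sup>2 / 2)) = exp (10 + b + b\<^sup>2 / 2)" by (simp add: exp_add)
  also have "\<dots> \<le> exp (t\<^sup>2 / 4)"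
  proof -
    have "b\<^sup>2 \<le> (t / 18)\<^sup>2" using bt b0 by (intro power_mono)
    then have "b\<^sup>2 \<le> t\<^sup>2 / 324" by (simp add: power_divide)
    moreover have "9 * t \<le> t\<^sup>2" using t9 by (simp add: power2_eq_square)
    ultimately have "10 + b + b\<^sup>2 / 2 \<le> t\<^sup>2 / 4" using bt t9 by linarith
    then show ?thesis by simp
  qed
  finally show ?thesis unfolding b_def t_def power2_abs by (simp add: mult_ac)
qed

text \<open>In high dimension \<open>x\<close> is 20 times a small constant vector plus a zero-sum
  vector, so \<open>3880 = 20 * (2 + 192)\<close>. In low dimension the body has bounded norm, and
  cutting \<open>x\<close> into \<open>1940 = 3880 / 2\<close> equal small pieces is enough.\<close>

lemma gaussian_body_subset_minkowski:
  assumes n: "1 \<le> n"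
    and inv: "permutation_invariant n A" "A \<subseteq> topspace (Rn n)" "2 / 3 \<le> measure (std_gaussian n) A"
  shows "gaussian_body n \<subseteq> minkowski_multiple n 3880 A"
proof
  fix x assume x: "x \<in> gaussian_body n"
  then have ext: "x \<in> extensional {..<n}" by (auto simp: gaussian_body_def topspace_Rn PiE_def)
  show "x \<in> minkowski_multiple n 3880 A"
  proof (cases "n < 49")
    case True
    have "(\<Sum>i<n. (x i / 1940)\<^sup>2) = (\<Sum>i<n. (x i)\<^sup>2) / 1940\<^sup>2"
      by (simp add: power_divide sum_divide_distrib)
    also have "\<dots> \<le> 1 / 25"
      using gaussian_body_sum_squares[OF x] True by (simp add: power2_eq_square)
    finally have "(\<lambda>i\<in>{..<n}. x i / 1940) \<in> minkowski_multiple n 2 A"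
      by (rule small_in_minkowski_two[OF inv(3)])
    then have "(\<lambda>i\<in>{..<n}. \<Sum>c<1940::nat. (\<lambda>i\<in>{..<n}. x i / 1940) i) \<in> minkowski_multiple n (1940 * 2) A"
      by (intro minkowski_multiple_sum)
    moreover have "(\<lambda>i\<in>{..<n}. \<Sum>c<1940::nat. (\<lambda>i\<in>{..<n}. x i / 1940) i) = x"
      using ext by (auto simp: fun_eq_iff extensional_def)
    ultimately show ?thesis by simp
  next
    case False
    define m where "m = (\<Sum>i<n. x i) / real n"
    define y where "y i = (x i - m) / 20" for i
    have "\<bar>\<Sum>i<n. x i\<bar> \<le> 4 * sqrt (real n)" using x by (simp add: gaussian_body_def)
    then have "\<bar>\<Sum>i<n. x i\<bar>\<^sup>2 \<le> (4 * sqrt (real n))\<^sup>2" by (intro power_mono) auto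
    then have "(\<Sum>i<n. x i)\<^sup>2 \<le> 16 * real n" by (simp add: power_mult_distrib)
    then have m2: "real n * m\<^sup>2 \<le> 16" using n by (simp add: m_def power_divide power2_eq_square field_simps)
    have "m\<^sup>2 \<le> 1"
    proof (rule ccontr)
      assume "\<not> ?thesis"
      then have "real n * 1 < real n * m\<^sup>2" using n by (intro mult_strict_left_mono) auto
      with m2 False show False by simp
    qed
    then have m1: "\<bar>m\<bar> \<le> 1" by (simp add: abs_square_le_1)
    \<comment> \<open>The scale 20 just meets the norm condition for small vectors:
      \<open>16 / 20\<^sup>2 = 1 / 25\<close>.\<close>
    have "(\<Sum>i<n. (m / 20)\<^sup>2) \<le> 1 / 25" using m2 by (simp add: power_divide)
    then have mean: "(\<lambda>i\<in>{..<n}. m / 20) \<in> minkowski_multiple n 2 A"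
      by (rule small_in_minkowski_two[OF inv(3)])
    have y: "(\<lambda>i\<in>{..<n}. y i) \<in> minkowski_multiple n 192 A"
    proof (rule zero_sum_in_minkowski[OF inv])
      show "48 \<le> n" using False by simp
      show "(\<Sum>i<n. y i) = 0"
        using n by (simp add: y_def sum_subtractf m_def flip: sum_divide_distrib)
      have "(\<Sum>i | i < n \<and> 1 / 2 < \<bar>y i\<bar>. (real (nat \<lceil>2 * \<bar>y i\<bar>\<rceil>) + 1) * exp ((y i)\<^sup>2 / 2))
          \<le> (\<Sum>i | i < n \<and> 1 / 2 < \<bar>y i\<bar>. exp ((x i)\<^sup>2 / 4) / 400)"
        unfolding y_def by (intro sum_mono gaussian_tail_cost m1) simp
      also have "\<dots> \<le> (\<Sum>i<n. exp ((x i)\<^sup>2 / 4) / 400)"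
        by (intro sum_mono2) auto
      also have "\<dots> \<le> real n / 100"
        using x by (simp add: gaussian_body_def flip: sum_divide_distrib)
      finally show "(\<Sum>i | i < n \<and> 1 / 2 < \<bar>y i\<bar>. (real (nat \<lceil>2 * \<bar>y i\<bar>\<rceil>) + 1) * exp ((y i)\<^sup>2 / 2)) \<le> real n / 100" .
    qed
    let ?z = "\<lambda>i\<in>{..<n}. (\<lambda>i\<in>{..<n}. m / 20) i + (\<lambda>i\<in>{..<n}. y i) i"
    have "(\<lambda>i\<in>{..<n}. \<Sum>c<20::nat. ?z i) \<in> minkowski_multiple n (20 * (2 + 192)) A"
      by (intro minkowski_multiple_sum minkowski_multiple_add mean y)
    moreover have "(\<lambda>i\<in>{..<n}. \<Sum>c<20::nat. ?z i) = x"
      using ext by (auto simp: fun_eq_iff extensional_def y_def field_simps)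
    ultimately show ?thesis by simp
  qed
qed

theorem corollary0p6:
  "\<exists>q::nat. q > 0 \<and>
     (\<forall>n\<ge>1. \<forall>A.
        permutation_invariant n A \<and> closedin (Rn n) A \<and> measure (std_gaussian n) A \<ge> 2/3 \<longrightarrow>
        (\<exists>K. permutation_invariant n K \<and> convex_body n K \<and>
             measure (std_gaussian n) K \<ge> 1/2 \<and> K \<subseteq> minkowski_multiple n q A))"
proof (intro exI[of _ 3880] conjI allI impI)
  fix n :: nat and A assume "1 \<le> n"
    and "permutation_invariant n A \<and> closedin (Rn n) A \<and> measure (std_gaussian n) A \<ge> 2/3"
  then show "\<exists>K. permutation_invariant n K \<and> convex_body n K \<and>
      measure (std_gaussian n) K \<ge> 1/2 \<and> K \<subseteq> minkowski_multiple n 3880 A"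
    using permutation_invariant_gaussian_body convex_body_gaussian_body measure_gaussian_body
      gaussian_body_subset_minkowski closedin_subset by blast
qed simp

end
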